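(* Let $s\ge\frac12$ be real and, for $r>0$ and $z\in\mathbf C^d$, let $\omega_{2,r,s}(z)=e^{\frac{|z|^2}2+r|z|^{\frac1s}}$. Consider the map $\mathcal P:\sum_{\alpha}c_\alpha e_\alpha\mapsto\big(z\mapsto\sum_{\alpha}c_\alpha z^\alpha/\sqrt{\alpha!}\big)$ from $\boldsymbol{\mathcal A}_0(\mathbf C^d)$ (finite sums) to $A(\mathbf C^d)$. Then the following is true: (1) $\mathcal P$ extends uniquely to a homeomorphism from $\boldsymbol{\mathcal A}_s'(\mathbf C^d)$ to $$\{F\in A(\mathbf C^d)\,;\,|F(z)|\lesssim\omega_{2,r,s}(z)\ \text{for every } r>0\};$$ (2) if in addition $s\ne\frac12$, then $\mathcal P$ extends uniquely to a homeomorphism from $\boldsymbol{\mathcal A}_{0,s}'(\mathbf C^d)$ to $$\{F\in A(\mathbf C^d)\,;\,|F(z)|\lesssim\omega_{2,r,s}(z)\ \text{for some } r>0\}.$$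
   Context: $A(\mathbf C^d)$ is the set of entire functions on $\mathbf C^d$; $f\lesssim g$ means $f\le cg$ for some constant $c>0$; $e_\alpha(z)=z^\alpha/\sqrt{\alpha!}$, $\alpha\in\mathbf N^d$. For $r>0$ let $\vartheta_{r,s}(\alpha)=e^{r|\alpha|^{1/(2s)}}$, and for $p\in(0,\infty]$ let $\ell^p_{[\vartheta]}(\mathbf N^d)$ be the quasi-Banach space of complex sequences with $\|\{c_\alpha\vartheta(\alpha)\}\|_{\ell^p}<\infty$. Let $\ell_s'(\mathbf N^d)=\bigcap_{r>0}\ell^p_{[1/\vartheta_{r,s}]}(\mathbf N^d)$ (projective limit topology) and $\ell_{0,s}'(\mathbf N^d)=\bigcup_{r>0}\ell^p_{[1/\vartheta_{r,s}]}(\mathbf N^d)$ (inductive limit topology); they are independent of $p$. The spaces $\boldsymbol{\mathcal A}_s'(\mathbf C^d)$ and $\boldsymbol{\mathcal A}_{0,s}'(\mathbf C^d)$ consist of all formal power series $\sum_\alpha c_\alpha e_\alpha$ with $\{c_\alpha\}$ in $\ell_s'(\mathbf N^d)$ and $\ell_{0,s}'(\mathbf N^d)$, respectively, with topologies transported from the sequence spaces; $\boldsymbol{\mathcal A}_0(\mathbf C^d)$ consists of the sums with finitely many nonzero $c_\alpha$. For a family $\{\omega_r\}_{r>0}$ of positive weights on $\mathbf C^d$, the set of $F\in A(\mathbf C^d)$ with $|F|\lesssim\omega_r$ for some (for every) $r>0$ carries the inductive (projective) limit topology of the Banach spaces $\{F\in A(\mathbf C^d)\,;\,\sup_z|F(z)|/\omega_r(z)<\infty\}$.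 *)

theory Defs
  imports "HOL-Analysis.Analysis"
begin

section \<open>Projective and inductive limits of spaces of complex-valued functions\<close>

text \<open>
  All spaces below are linear subspaces of \<^typ>\<open>'i \<Rightarrow> complex\<close> with the pointwise operations. A step
  is a carrier together with a quasi-norm on it (only a quasi-norm, because of \<open>\<ell>\<^sup>p\<close> with \<open>p < 1\<close>),
  and a family of steps is indexed by the positive reals.
\<close>

definition quasinorm_topology ::
    "('i \<Rightarrow> complex) set \<Rightarrow> (('i \<Rightarrow> complex) \<Rightarrow> real) \<Rightarrow> ('i \<Rightarrow> complex) topology" where
  "quasinorm_topology X N = topology (\<lambda>U. U \<subseteq> X \<and>
     (\<forall>x\<in>U. \<exists>\<epsilon>>0. \<forall>y\<in>X. N (\<lambda>i. y i - x i) < \<epsilon> \<longrightarrow> y \<in> U))"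

text \<open>The coarsest topology on the intersection making all inclusions into the steps continuous.\<close>

definition projective_limit ::
    "(real \<Rightarrow> ('i \<Rightarrow> complex) set) \<Rightarrow> (real \<Rightarrow> ('i \<Rightarrow> complex) \<Rightarrow> real) \<Rightarrow> ('i \<Rightarrow> complex) topology" where
  "projective_limit X N = topology_generated_by
     {(\<Inter>t\<in>{0<..}. X t) \<inter> U | r U. r > 0 \<and> openin (quasinorm_topology (X r) (N r)) U}"

definition absolutely_convex :: "('i \<Rightarrow> complex) set \<Rightarrow> bool" where
  "absolutely_convex V \<longleftrightarrow>
     (\<forall>x\<in>V. \<forall>y\<in>V. \<forall>a b. norm a + norm b \<le> 1 \<longrightarrow> (\<lambda>i. a * x i + b * y i) \<in> V)"

text \<open>
  The finest locally convex topology on the union making all inclusions of the steps continuous: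
  a base of neighbourhoods of \<open>0\<close> is given by the absolutely convex sets whose trace on every step
  is a neighbourhood of \<open>0\<close> in that step. Only \<open>V \<inter> (\<Union>r\<in>{0<..}. X r)\<close> matters.
\<close>

definition inductive_limit ::
    "(real \<Rightarrow> ('i \<Rightarrow> complex) set) \<Rightarrow> (real \<Rightarrow> ('i \<Rightarrow> complex) \<Rightarrow> real) \<Rightarrow> ('i \<Rightarrow> complex) topology" where
  "inductive_limit X N = topology (\<lambda>U. U \<subseteq> (\<Union>r\<in>{0<..}. X r) \<and>
     (\<forall>x\<in>U. \<exists>V. absolutely_convex V \<and>
        (\<forall>r>0. \<exists>W. openin (quasinorm_topology (X r) (N r)) W \<and> (\<lambda>_. 0) \<in> W \<and> W \<subseteq> V) \<and>
        (\<forall>y\<in>(\<Union>r\<in>{0<..}. X r). (\<lambda>i. y i - x i) \<in> V \<longrightarrow> y \<in> U)))"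

lemma openin_quasinorm_topology:
  "openin (quasinorm_topology X N) U \<longleftrightarrow> U \<subseteq> X \<and>
     (\<forall>x\<in>U. \<exists>\<epsilon>>0. \<forall>y\<in>X. N (\<lambda>i. y i - x i) < \<epsilon> \<longrightarrow> y \<in> U)"
proof -
  define P where "P = (\<lambda>U. U \<subseteq> X \<and> (\<forall>x\<in>U. \<exists>\<epsilon>>0. \<forall>y\<in>X. N (\<lambda>i. y i - x i) < \<epsilon> \<longrightarrow> y \<in> U))"
  have P_Int: "P (S \<inter> T)" if S: "P S" and T: "P T" for S T
    unfolding P_def
  proof (intro conjI ballI)
    show "S \<inter> T \<subseteq> X" using S unfolding P_def by blast
    fix x assume x: "x \<in> S \<inter> T"
    obtain e1 where e1: "e1 > 0" "\<forall>y\<in>X. N (\<lambda>i. y i - x i) < e1 \<longrightarrow> y \<in> S"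
      using S x unfolding P_def by blast
    obtain e2 where e2: "e2 > 0" "\<forall>y\<in>X. N (\<lambda>i. y i - x i) < e2 \<longrightarrow> y \<in> T"
      using T x unfolding P_def by blast
    show "\<exists>\<epsilon>>0. \<forall>y\<in>X. N (\<lambda>i. y i - x i) < \<epsilon> \<longrightarrow> y \<in> S \<inter> T"
      using e1 e2 by (intro exI[of _ "min e1 e2"]) auto
  qed
  have P_Un: "P (\<Union>K)" if K: "\<And>S. S \<in> K \<Longrightarrow> P S" for K
    unfolding P_def
  proof (intro conjI ballI)
    show "\<Union>K \<subseteq> X" using K unfolding P_def by (simp add: Sup_least)
    fix x assume "x \<in> \<Union>K"
    then obtain S where S: "S \<in> K" "x \<in> S" by blast
    then obtain e where "e > 0" "\<forall>y\<in>X. N (\<lambda>i. y i - x i) < e \<longrightarrow> y \<in> S"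
      using K unfolding P_def by meson
    then show "\<exists>\<epsilon>>0. \<forall>y\<in>X. N (\<lambda>i. y i - x i) < \<epsilon> \<longrightarrow> y \<in> \<Union>K" using S by blast
  qed
  have "istopology P" unfolding istopology_def using P_Int P_Un by blast
  then have "openin (topology P) U \<longleftrightarrow> P U" by (simp add: topology_inverse')
  then show ?thesis unfolding quasinorm_topology_def P_def .
qed

lemma topspace_quasinorm_topology [simp]: "topspace (quasinorm_topology X N) = X"
proof
  show "topspace (quasinorm_topology X N) \<subseteq> X"
    by (simp add: topspace_def openin_quasinorm_topology) blast
  have "openin (quasinorm_topology X N) X"
    unfolding openin_quasinorm_topology by (auto intro: exI[of _ 1])
  then show "X \<subseteq> topspace (quasinorm_topology X N)" by (rule openin_subset)
qed

lemma topspace_projective_limit [simp]: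
  "topspace (projective_limit X N) = (\<Inter>r\<in>{0<..}. X r)"
proof
  show "topspace (projective_limit X N) \<subseteq> (\<Inter>r\<in>{0<..}. X r)"
    unfolding projective_limit_def topology_generated_by_topspace by blast
  have "openin (quasinorm_topology (X 1) (N 1)) (X 1)"
    using openin_topspace[of "quasinorm_topology (X 1) (N 1)"] by simp
  then have "(\<Inter>t\<in>{0<..}. X t) \<inter> X 1 \<in>
    {(\<Inter>t\<in>{0<..}. X t) \<inter> U | r U. r > 0 \<and> openin (quasinorm_topology (X r) (N r)) U}"
    using zero_less_one by blast
  then have "(\<Inter>t\<in>{0<..}. X t) \<inter> X 1 \<subseteq> topspace (projective_limit X N)"
    unfolding projective_limit_def topology_generated_by_topspace by (rule Union_upper)
  then show "(\<Inter>r\<in>{0<..}. X r) \<subseteq> topspace (projective_limit X N)" by auto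
qed

lemma openin_inductive_limit:
  "openin (inductive_limit X N) U \<longleftrightarrow> U \<subseteq> (\<Union>r\<in>{0<..}. X r) \<and>
     (\<forall>x\<in>U. \<exists>V. absolutely_convex V \<and>
        (\<forall>r>0. \<exists>W. openin (quasinorm_topology (X r) (N r)) W \<and> (\<lambda>_. 0) \<in> W \<and> W \<subseteq> V) \<and>
        (\<forall>y\<in>(\<Union>r\<in>{0<..}. X r). (\<lambda>i. y i - x i) \<in> V \<longrightarrow> y \<in> U))"
proof -
  define E where "E = (\<Union>r\<in>{0<..}. X r)"
  define nb where "nb V \<longleftrightarrow> absolutely_convex V \<and>
    (\<forall>r>0. \<exists>W. openin (quasinorm_topology (X r) (N r)) W \<and> (\<lambda>_. 0) \<in> W \<and> W \<subseteq> V)" for V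
  define P where "P = (\<lambda>U. U \<subseteq> E \<and> (\<forall>x\<in>U. \<exists>V. nb V \<and> (\<forall>y\<in>E. (\<lambda>i. y i - x i) \<in> V \<longrightarrow> y \<in> U)))"
  have nb_Int: "nb (V \<inter> V')" if V: "nb V" and V': "nb V'" for V V'
    unfolding nb_def
  proof (intro conjI allI impI)
    show "absolutely_convex (V \<inter> V')"
      using V V' unfolding nb_def absolutely_convex_def by blast
    fix r :: real assume "r > 0"
    then obtain W W' where "openin (quasinorm_topology (X r) (N r)) W" "(\<lambda>_. 0) \<in> W" "W \<subseteq> V"
      "openin (quasinorm_topology (X r) (N r)) W'" "(\<lambda>_. 0) \<in> W'" "W' \<subseteq> V'"
      using V V' unfolding nb_def by meson
    then show "\<exists>W. openin (quasinorm_topology (X r) (N r)) W \<and> (\<lambda>_. 0) \<in> W \<and> W \<subseteq> V \<inter> V'"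
      by (intro exI[of _ "W \<inter> W'"]) (auto intro: openin_Int)
  qed
  have P_Int: "P (S \<inter> T)" if S: "P S" and T: "P T" for S T
    unfolding P_def
  proof (intro conjI ballI)
    show "S \<inter> T \<subseteq> E" using S unfolding P_def by blast
    fix x assume x: "x \<in> S \<inter> T"
    obtain V where V: "nb V" "\<forall>y\<in>E. (\<lambda>i. y i - x i) \<in> V \<longrightarrow> y \<in> S"
      using S x unfolding P_def by blast
    obtain V' where V': "nb V'" "\<forall>y\<in>E. (\<lambda>i. y i - x i) \<in> V' \<longrightarrow> y \<in> T"
      using T x unfolding P_def by blast
    show "\<exists>V. nb V \<and> (\<forall>y\<in>E. (\<lambda>i. y i - x i) \<in> V \<longrightarrow> y \<in> S \<inter> T)"
      using V V' nb_Int by (intro exI[of _ "V \<inter> V'"]) auto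
  qed
  have P_Un: "P (\<Union>K)" if K: "\<And>S. S \<in> K \<Longrightarrow> P S" for K
    unfolding P_def
  proof (intro conjI ballI)
    show "\<Union>K \<subseteq> E" using K unfolding P_def by (simp add: Sup_least)
    fix x assume "x \<in> \<Union>K"
    then obtain S where S: "S \<in> K" "x \<in> S" by blast
    then obtain V where "nb V" "\<forall>y\<in>E. (\<lambda>i. y i - x i) \<in> V \<longrightarrow> y \<in> S"
      using K unfolding P_def by meson
    then show "\<exists>V. nb V \<and> (\<forall>y\<in>E. (\<lambda>i. y i - x i) \<in> V \<longrightarrow> y \<in> \<Union>K)" using S unfolding P_def by blast
  qed
  have "istopology P" unfolding istopology_def using P_Int P_Un by blast
  then have "openin (topology P) U \<longleftrightarrow> P U" by (simp add: topology_inverse')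
  then show ?thesis unfolding inductive_limit_def P_def nb_def E_def by (simp only: conj_assoc)
qed

lemma topspace_inductive_limit [simp]:
  assumes "\<And>r. r > 0 \<Longrightarrow> (\<lambda>_. 0) \<in> X r"
  shows "topspace (inductive_limit X N) = (\<Union>r\<in>{0<..}. X r)"
proof
  show "topspace (inductive_limit X N) \<subseteq> (\<Union>r\<in>{0<..}. X r)"
    using openin_topspace[of "inductive_limit X N"] unfolding openin_inductive_limit by blast
  have "absolutely_convex UNIV" by (simp add: absolutely_convex_def)
  moreover have "\<exists>W. openin (quasinorm_topology (X r) (N r)) W \<and> (\<lambda>_. 0) \<in> W \<and> W \<subseteq> UNIV"
    if "r > 0" for r
    using assms[OF that] openin_topspace[of "quasinorm_topology (X r) (N r)"]
    by (intro exI[of _ "X r"]) simp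
  ultimately have "openin (inductive_limit X N) (\<Union>r\<in>{0<..}. X r)"
    unfolding openin_inductive_limit by (intro conjI ballI exI[of _ UNIV]) auto
  then show "(\<Union>r\<in>{0<..}. X r) \<subseteq> topspace (inductive_limit X N)" by (rule openin_subset)
qed


section \<open>Multi-indices and weighted sequence spaces\<close>

definition mi_length :: "nat ^ 'd \<Rightarrow> nat" where
  "mi_length \<alpha> = (\<Sum>i\<in>UNIV. \<alpha> $ i)"

definition mi_fact :: "nat ^ 'd \<Rightarrow> nat" where
  "mi_fact \<alpha> = (\<Prod>i\<in>UNIV. fact (\<alpha> $ i))"

definition mi_power :: "complex ^ 'd \<Rightarrow> nat ^ 'd \<Rightarrow> complex" where
  "mi_power z \<alpha> = (\<Prod>i\<in>UNIV. (z $ i) ^ (\<alpha> $ i))"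

definition e_basis :: "nat ^ 'd \<Rightarrow> complex ^ 'd \<Rightarrow> complex" where
  "e_basis \<alpha> z = mi_power z \<alpha> / complex_of_real (sqrt (real (mi_fact \<alpha>)))"

text \<open>\<open>\<ell>\<^sup>p\<close> for \<open>p \<in> (0, \<infinity>]\<close>; the value \<open>p = \<infinity>\<close> is \<^term>\<open>top :: ennreal\<close>.\<close>

definition lp_set :: "ennreal \<Rightarrow> ('i \<Rightarrow> complex) set" where
  "lp_set p = {c. if p = \<infinity> then bdd_above (range (\<lambda>\<alpha>. norm (c \<alpha>)))
                  else (\<lambda>\<alpha>. norm (c \<alpha>) powr enn2real p) summable_on UNIV}"

definition lp_norm :: "ennreal \<Rightarrow> ('i \<Rightarrow> complex) \<Rightarrow> real" where
  "lp_norm p c = (if p = \<infinity> then (SUP \<alpha>. norm (c \<alpha>))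
                  else (\<Sum>\<^sub>\<infinity>\<alpha>. norm (c \<alpha>) powr enn2real p) powr (1 / enn2real p))"

definition weighted_lp :: "ennreal \<Rightarrow> ('i \<Rightarrow> real) \<Rightarrow> ('i \<Rightarrow> complex) set" where
  "weighted_lp p \<theta> = {c. (\<lambda>\<alpha>. c \<alpha> * of_real (\<theta> \<alpha>)) \<in> lp_set p}"

definition weighted_lp_norm :: "ennreal \<Rightarrow> ('i \<Rightarrow> real) \<Rightarrow> ('i \<Rightarrow> complex) \<Rightarrow> real" where
  "weighted_lp_norm p \<theta> c = lp_norm p (\<lambda>\<alpha>. c \<alpha> * of_real (\<theta> \<alpha>))"

definition vartheta :: "real \<Rightarrow> real \<Rightarrow> nat ^ 'd \<Rightarrow> real" where
  "vartheta r s \<alpha> = exp (r * real (mi_length \<alpha>) powr (1 / (2 * s)))"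


section \<open>Spaces of formal power series\<close>

text \<open>
  A formal power series \<open>\<Sum>\<^sub>\<alpha> c\<^sub>\<alpha> e\<^sub>\<alpha>\<close> is represented by its coefficient family \<open>c\<close>, so the spaces
  of formal power series and their topologies are those of the coefficient families.
  \<open>A_s_dual p s\<close> and \<open>A_0s_dual p s\<close> carry the exponent \<open>p\<close> used in the defining \<open>\<ell>\<^sup>p\<close>-spaces.
\<close>

definition A_s_dual :: "ennreal \<Rightarrow> real \<Rightarrow> (nat ^ 'd \<Rightarrow> complex) topology" where
  "A_s_dual p s = projective_limit
     (\<lambda>r. weighted_lp p (\<lambda>\<alpha>. 1 / vartheta r s \<alpha>))
     (\<lambda>r. weighted_lp_norm p (\<lambda>\<alpha>. 1 / vartheta r s \<alpha>))"

definition A_0s_dual :: "ennreal \<Rightarrow> real \<Rightarrow> (nat ^ 'd \<Rightarrow> complex) topology" where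
  "A_0s_dual p s = inductive_limit
     (\<lambda>r. weighted_lp p (\<lambda>\<alpha>. 1 / vartheta r s \<alpha>))
     (\<lambda>r. weighted_lp_norm p (\<lambda>\<alpha>. 1 / vartheta r s \<alpha>))"

definition A_0 :: "(nat ^ 'd \<Rightarrow> complex) set" where
  "A_0 = {c. finite {\<alpha>. c \<alpha> \<noteq> 0}}"

definition P_map :: "(nat ^ 'd \<Rightarrow> complex) \<Rightarrow> complex ^ 'd \<Rightarrow> complex" where
  "P_map c = (\<lambda>z. \<Sum>\<alpha> | c \<alpha> \<noteq> 0. c \<alpha> * e_basis \<alpha> z)"


section \<open>Weighted spaces of entire functions\<close>

text \<open>Entire functions of several variables: the real Frechet derivative is complex linear.\<close>

definition entire :: "(complex ^ 'd \<Rightarrow> complex) set" where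
  "entire = {F. \<forall>z. \<exists>D. (F has_derivative D) (at z) \<and> (\<forall>c v. D (c *s v) = c * D v)}"

definition lesssim :: "('a \<Rightarrow> real) \<Rightarrow> ('a \<Rightarrow> real) \<Rightarrow> bool" where
  "lesssim f g \<longleftrightarrow> (\<exists>c>0. \<forall>x. f x \<le> c * g x)"

definition weighted_entire :: "(complex ^ 'd \<Rightarrow> real) \<Rightarrow> (complex ^ 'd \<Rightarrow> complex) set" where
  "weighted_entire \<omega> = {F \<in> entire. bdd_above (range (\<lambda>z. norm (F z) / \<omega> z))}"

definition weighted_entire_norm :: "(complex ^ 'd \<Rightarrow> real) \<Rightarrow> (complex ^ 'd \<Rightarrow> complex) \<Rightarrow> real" where
  "weighted_entire_norm \<omega> F = (SUP z. norm (F z) / \<omega> z)"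

definition entire_every :: "(real \<Rightarrow> complex ^ 'd \<Rightarrow> real) \<Rightarrow> (complex ^ 'd \<Rightarrow> complex) topology" where
  "entire_every \<omega> = projective_limit (\<lambda>r. weighted_entire (\<omega> r)) (\<lambda>r. weighted_entire_norm (\<omega> r))"

definition entire_some :: "(real \<Rightarrow> complex ^ 'd \<Rightarrow> real) \<Rightarrow> (complex ^ 'd \<Rightarrow> complex) topology" where
  "entire_some \<omega> = inductive_limit (\<lambda>r. weighted_entire (\<omega> r)) (\<lambda>r. weighted_entire_norm (\<omega> r))"

definition omega2 :: "real \<Rightarrow> real \<Rightarrow> complex ^ 'd \<Rightarrow> real" where
  "omega2 r s z = exp ((norm z)\<^sup>2 / 2 + r * norm z powr (1 / s))"

lemma weighted_entire_iff:
  assumes "\<And>z. \<omega> z > 0"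
  shows "F \<in> weighted_entire \<omega> \<longleftrightarrow> F \<in> entire \<and> lesssim (\<lambda>z. norm (F z)) \<omega>"
proof -
  have "bdd_above (range (\<lambda>z. norm (F z) / \<omega> z)) \<longleftrightarrow> lesssim (\<lambda>z. norm (F z)) \<omega>"
  proof
    assume "bdd_above (range (\<lambda>z. norm (F z) / \<omega> z))"
    then obtain B where B: "\<And>z. norm (F z) / \<omega> z \<le> B" by (auto simp: bdd_above_def)
    have "norm (F z) \<le> max B 1 * \<omega> z" for z
    proof -
      have "norm (F z) / \<omega> z \<le> max B 1" using B[of z] by simp
      then show ?thesis using assms[of z] by (simp add: pos_divide_le_eq)
    qed
    then show "lesssim (\<lambda>z. norm (F z)) \<omega>"
      unfolding lesssim_def by (intro exI[of _ "max B 1"]) auto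
  next
    assume "lesssim (\<lambda>z. norm (F z)) \<omega>"
    then show "bdd_above (range (\<lambda>z. norm (F z) / \<omega> z))"
      using assms unfolding lesssim_def bdd_above_def by (auto simp: pos_divide_le_eq)
  qed
  then show ?thesis by (simp add: weighted_entire_def)
qed

lemma zero_in_weighted_entire: "(\<lambda>_. 0) \<in> weighted_entire \<omega>"
proof -
  have "((\<lambda>_. 0 :: complex) has_derivative (\<lambda>_. 0)) (at z)" for z :: "complex ^ 'd"
    by (rule has_derivative_const)
  then have "(\<lambda>_. 0 :: complex) \<in> (entire :: (complex ^ 'd \<Rightarrow> complex) set)"
    unfolding entire_def by (auto intro!: exI[of _ "\<lambda>_. 0 :: complex"])
  then show ?thesis by (simp add: weighted_entire_def)
qed

lemma topspace_entire_every:
  assumes "\<And>r z. r > 0 \<Longrightarrow> \<omega> r z > 0"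
  shows "topspace (entire_every \<omega>) = {F \<in> entire. \<forall>r>0. lesssim (\<lambda>z. norm (F z)) (\<omega> r)}"
proof -
  have "(\<Inter>r\<in>{0<..}. weighted_entire (\<omega> r)) \<subseteq> entire"
    using zero_less_one[where 'a = real] unfolding weighted_entire_def by blast
  then show ?thesis
    unfolding entire_every_def topspace_projective_limit by (auto simp: weighted_entire_iff assms)
qed

lemma topspace_entire_some:
  assumes "\<And>r z. r > 0 \<Longrightarrow> \<omega> r z > 0"
  shows "topspace (entire_some \<omega>) = {F \<in> entire. \<exists>r>0. lesssim (\<lambda>z. norm (F z)) (\<omega> r)}"
  unfolding entire_some_def by (auto simp: weighted_entire_iff assms zero_in_weighted_entire)

lemma topspace_A_s_dual:
  "topspace (A_s_dual p s) = (\<Inter>r\<in>{0<..}. weighted_lp p (\<lambda>\<alpha>. 1 / vartheta r s \<alpha>))"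
  by (simp add: A_s_dual_def)

lemma topspace_A_0s_dual:
  "topspace (A_0s_dual p s) = (\<Union>r\<in>{0<..}. weighted_lp p (\<lambda>\<alpha>. 1 / vartheta r s \<alpha>))"
  by (simp add: A_0s_dual_def weighted_lp_def lp_set_def)


section \<open>Unique extension to a homeomorphism\<close>

text \<open>
  Maps on a topological space are identified when they agree on its carrier; to express uniqueness
  for total functions, the extension is normalised to be \<^term>\<open>undefined\<close> off the carrier.
\<close>

definition extends_uniquely_to_homeomorphism ::
    "('a \<Rightarrow> 'b) \<Rightarrow> 'a set \<Rightarrow> 'a topology \<Rightarrow> 'b topology \<Rightarrow> bool" where
  "extends_uniquely_to_homeomorphism f D X Y \<longleftrightarrow> D \<subseteq> topspace X \<and>
     (\<exists>!g. g \<in> extensional (topspace X) \<and> homeomorphic_map X Y g \<and> (\<forall>x\<in>D. g x = f x))"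

end

theory Submission
  imports Defs "HOL-Complex_Analysis.Cauchy_Integral_Formula" "HOL-Real_Asymp.Real_Asymp"
begin

text \<open>
  Write \<open>X r\<close> for the weighted sequence space with weight \<open>1 / vartheta r s\<close>, \<open>Y r\<close> for the space of
  entire functions dominated by \<open>omega2 r s\<close>, and \<open>a = 1 / (2 * s)\<close>, so that \<open>0 < a \<le> 1\<close>, the sequences
  in \<open>X r\<close> are \<open>O(exp (r * n\<^sup>a))\<close> with \<open>n = |\<alpha>|\<close>, and \<open>omega2 r s z = exp (x / 2 + r * x\<^sup>a)\<close> with \<open>x = |z|\<^sup>2\<close>.
  Summation of the series and taking Taylor coefficients are inverse to each other, and each of them
  is bounded from a step of one scale into a step of the other, at the price of a change of \<open>r\<close>:

  \<^item> Summation maps \<open>X r\<close> into \<open>Y (growth_shift r)\<close> (\<open>basis_series_bound\<close>). By the Cauchy--Schwarz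
    inequality the series is controlled by the square root of \<open>\<Sum>\<^sub>\<alpha> exp (4 * r * n\<^sup>a) * |e\<^sub>\<alpha>(z)|\<^sup>2\<close>. The
    sum without the weight is \<open>exp x\<close>, with terms concentrated where \<open>n\<close> is about \<open>x\<close>; since
    \<open>n\<^sup>a \<le> x\<^sup>a + x\<^sup>a\<^sup>-\<^sup>1 * n\<close>, the weight costs only a factor \<open>exp (const * x\<^sup>a)\<close>.

  \<^item> The Taylor map sends \<open>Y r\<close> into \<open>X (4 * r)\<close> (\<open>taylor_map_seq_bound\<close>). Cauchy's estimate for the
    coefficient with index \<open>\<alpha>\<close>, applied at the point with coordinates \<open>sqrt (\<alpha>\<^sub>i)\<close>, where \<open>|z|\<^sup>2 = n\<close> and
    \<open>|e\<^sub>\<alpha>(z)|\<close> is almost \<open>exp (n / 2)\<close>, loses only a power of \<open>n\<close>, which a larger \<open>r\<close> absorbs.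

  The second shift is linear in \<open>r\<close> and the first tends to \<open>0\<close> with \<open>r\<close>, so both maps are continuous for
  the projective limits as well as for the inductive limits. All exponents \<open>p\<close> lead to the same limits, because
  a sup bound with weight parameter \<open>r\<close> gives an \<open>\<ell>\<^sup>p\<close> bound with parameter \<open>2 * r\<close>
  (\<open>seq_step_sup_bound\<close>). The homeomorphic extension is unique because truncations of a sequence converge to
  it, so that finite sums are dense, and because point evaluations are continuous and separate entire functions.

  Taylor expansion in several variables rests on one-variable theory applied coordinatewise: the
  part of \<open>F\<close> that is homogeneous of degree \<open>k\<close> in the \<open>j\<close>-th coordinate is the \<open>k\<close>-th Taylor
  coefficient, in \<open>l\<close>, of \<open>F\<close> with its \<open>j\<close>-th argument multiplied by \<open>l\<close>. It is again entire
  (\<open>entire_hom_part\<close>), so the construction can be iterated over the coordinates, and what remains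
  after all of them is a monomial.
\<close>

(* Below, the dollar sign always selects a vector component. *)
no_notation fps_nth (infixl \<open>$\<close> 75)

section \<open>Continuity and density in limits of scales\<close>

definition linear_scale :: "(real \<Rightarrow> ('i \<Rightarrow> complex) set) \<Rightarrow> bool" where
  "linear_scale X \<longleftrightarrow>
     (\<forall>r>0. (\<lambda>_. 0) \<in> X r \<and> (\<forall>x\<in>X r. \<forall>y\<in>X r. \<forall>a b. (\<lambda>i. a * x i + b * y i) \<in> X r)) \<and>
     (\<forall>r r'. 0 < r \<longrightarrow> r \<le> r' \<longrightarrow> X r \<subseteq> X r')"

definition complex_linear_on ::
    "('i \<Rightarrow> complex) set \<Rightarrow> (('i \<Rightarrow> complex) \<Rightarrow> ('j \<Rightarrow> complex)) \<Rightarrow> bool" where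
  "complex_linear_on E g \<longleftrightarrow>
     (\<forall>x\<in>E. \<forall>y\<in>E. \<forall>a b. g (\<lambda>i. a * x i + b * y i) = (\<lambda>j. a * g x j + b * g y j))"

lemma linear_scaleD:
  assumes "linear_scale X" "r > 0"
  shows "(\<lambda>_. 0) \<in> X r"
    and "\<And>x y a b. x \<in> X r \<Longrightarrow> y \<in> X r \<Longrightarrow> (\<lambda>i. a * x i + b * y i) \<in> X r"
    and "\<And>r'. r \<le> r' \<Longrightarrow> X r \<subseteq> X r'"
  using assms unfolding linear_scale_def by blast+

lemma linear_scale_diff:
  assumes "linear_scale X" "r > 0" "x \<in> X r" "y \<in> X r"
  shows "(\<lambda>i. x i - y i) \<in> X r"
  using linear_scaleD(2)[OF assms, of 1 "-1"] by simp

lemma linear_scale_Union: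
  assumes X: "linear_scale X" and x: "x \<in> (\<Union>r\<in>{0<..}. X r)" and y: "y \<in> (\<Union>r\<in>{0<..}. X r)"
  shows "(\<lambda>i. a * x i + b * y i) \<in> (\<Union>r\<in>{0<..}. X r)"
proof -
  obtain r r' where r: "r > 0" "x \<in> X r" "r' > 0" "y \<in> X r'" using x y by auto
  then have "x \<in> X (max r r')" "y \<in> X (max r r')"
    using linear_scaleD(3)[OF X, of r "max r r'"] linear_scaleD(3)[OF X, of r' "max r r'"] by auto
  moreover have "max r r' > 0" using r by simp
  ultimately show ?thesis using linear_scaleD(2)[OF X] by blast
qed

lemma complex_linear_on_diff:
  assumes "complex_linear_on E g" "x \<in> E" "y \<in> E"
  shows "g (\<lambda>i. x i - y i) = (\<lambda>j. g x j - g y j)"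
proof -
  have "g (\<lambda>i. 1 * x i + (-1) * y i) = (\<lambda>j. 1 * g x j + (-1) * g y j)"
    using assms unfolding complex_linear_on_def by blast
  then show ?thesis by simp
qed

lemma complex_linear_on_zero:
  assumes "complex_linear_on E g" "x \<in> E"
  shows "g (\<lambda>_. 0) = (\<lambda>_. 0)"
  using complex_linear_on_diff[OF assms(1,2,2)] by simp

text \<open>
  Balls of a quasi-norm need not be open, so continuity is obtained by pulling back open sets: a
  linear map that is bounded in the quasi-norms turns a radius that fits into an open set around
  \<open>g x\<close> into one that fits around \<open>x\<close>.
\<close>

lemma openin_preimage_step:
  assumes X: "linear_scale X" "r > 0" and E: "X r \<subseteq> E" "complex_linear_on E g"
    and C: "C > 0" and bound: "\<And>x. x \<in> X r \<Longrightarrow> g x \<in> Y \<and> M (g x) \<le> C * N x"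
    and W: "openin (quasinorm_topology Y M) W"
  shows "openin (quasinorm_topology (X r) N) {x \<in> X r. g x \<in> W}"
  unfolding openin_quasinorm_topology
proof (intro conjI ballI)
  fix x assume x: "x \<in> {x \<in> X r. g x \<in> W}"
  then obtain e where e: "e > 0" "\<And>h. h \<in> Y \<Longrightarrow> M (\<lambda>i. h i - g x i) < e \<Longrightarrow> h \<in> W"
    using W unfolding openin_quasinorm_topology by blast
  show "\<exists>\<epsilon>>0. \<forall>y\<in>X r. N (\<lambda>i. y i - x i) < \<epsilon> \<longrightarrow> y \<in> {x \<in> X r. g x \<in> W}"
  proof (intro exI conjI ballI impI)
    show "e / C > 0" using e C by simp
    fix y assume y: "y \<in> X r" and N: "N (\<lambda>i. y i - x i) < e / C"
    have d: "(\<lambda>i. y i - x i) \<in> X r" using linear_scale_diff[OF X y] x by simp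
    have "g (\<lambda>i. y i - x i) = (\<lambda>i. g y i - g x i)"
      using complex_linear_on_diff[OF E(2)] x y E(1) by auto
    then have "M (\<lambda>i. g y i - g x i) \<le> C * N (\<lambda>i. y i - x i)" using bound[OF d] by simp
    also have "\<dots> < e" using N C by (simp add: pos_less_divide_eq mult.commute)
    finally show "y \<in> {x \<in> X r. g x \<in> W}" using e(2)[of "g y"] bound[OF y] y by simp
  qed
qed auto

text \<open>
  An open set of one step of the target pulls back to an open set of one step of the source; therefore
  every target step \<open>r\<close> has to receive some source step \<open>r'\<close>.
\<close>

lemma continuous_map_projective_limit:
  assumes X: "linear_scale X" and g: "complex_linear_on (\<Union>r\<in>{0<..}. X r) g"
    and bound: "\<And>r. r > 0 \<Longrightarrow> \<exists>r'>0. \<exists>C>0. \<forall>x\<in>X r'. g x \<in> Y r \<and> M r (g x) \<le> C * N r' x"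
  shows "continuous_map (projective_limit X N) (projective_limit Y M) g"
proof -
  have into: "g x \<in> (\<Inter>t\<in>{0<..}. Y t)" if "x \<in> (\<Inter>t\<in>{0<..}. X t)" for x
    using that bound by fastforce
  show ?thesis
    unfolding projective_limit_def[of Y M]
  proof (rule continuous_on_generated_topo)
    fix V assume "V \<in> {(\<Inter>t\<in>{0<..}. Y t) \<inter> U |r U. r > 0 \<and> openin (quasinorm_topology (Y r) (M r)) U}"
    then obtain r U where r: "r > 0" and U: "openin (quasinorm_topology (Y r) (M r)) U"
      and V: "V = (\<Inter>t\<in>{0<..}. Y t) \<inter> U" by blast
    obtain r' C where r': "r' > 0" "C > 0" "\<And>x. x \<in> X r' \<Longrightarrow> g x \<in> Y r \<and> M r (g x) \<le> C * N r' x"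
      using bound[OF r] by blast
    have "openin (quasinorm_topology (X r') (N r')) {x \<in> X r'. g x \<in> U}"
      using openin_preimage_step[OF X r'(1) _ g r'(2) r'(3) U] r'(1) by blast
    then have "openin (projective_limit X N) ((\<Inter>t\<in>{0<..}. X t) \<inter> {x \<in> X r'. g x \<in> U})"
      unfolding projective_limit_def using r'(1) by (intro topology_generated_by_Basis) blast
    moreover have "(\<Inter>t\<in>{0<..}. X t) \<inter> {x \<in> X r'. g x \<in> U}
        = g -` V \<inter> topspace (projective_limit X N)"
      using r'(1) into V by auto
    ultimately show "openin (projective_limit X N) (g -` V \<inter> topspace (projective_limit X N))"
      by simp
  next
    have "topspace (projective_limit Y M) = (\<Inter>t\<in>{0<..}. Y t)" by simp
    then have "\<Union>{(\<Inter>t\<in>{0<..}. Y t) \<inter> U |r U. r > 0 \<and> openin (quasinorm_topology (Y r) (M r)) U}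
        = (\<Inter>t\<in>{0<..}. Y t)"
      unfolding projective_limit_def topology_generated_by_topspace .
    then show "g ` topspace (projective_limit X N) \<subseteq>
      \<Union>{(\<Inter>t\<in>{0<..}. Y t) \<inter> U |r U. r > 0 \<and> openin (quasinorm_topology (Y r) (M r)) U}"
      using into by auto
  qed
qed

definition zero_neighbourhood ::
    "(real \<Rightarrow> ('i \<Rightarrow> complex) set) \<Rightarrow> (real \<Rightarrow> ('i \<Rightarrow> complex) \<Rightarrow> real) \<Rightarrow> ('i \<Rightarrow> complex) set \<Rightarrow> bool" where
  "zero_neighbourhood X N V \<longleftrightarrow> absolutely_convex V \<and>
     (\<forall>r>0. \<exists>W. openin (quasinorm_topology (X r) (N r)) W \<and> (\<lambda>_. 0) \<in> W \<and> W \<subseteq> V)"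

lemma openin_inductive_limit_iff:
  "openin (inductive_limit X N) U \<longleftrightarrow> U \<subseteq> (\<Union>r\<in>{0<..}. X r) \<and>
     (\<forall>x\<in>U. \<exists>V. zero_neighbourhood X N V \<and>
        (\<forall>y\<in>(\<Union>r\<in>{0<..}. X r). (\<lambda>i. y i - x i) \<in> V \<longrightarrow> y \<in> U))"
  unfolding openin_inductive_limit zero_neighbourhood_def conj_assoc ..

text \<open>
  The preimage of an absolutely convex neighbourhood of zero is absolutely convex by linearity, and its trace
  on each step is a neighbourhood of zero; here every source step \<open>r\<close> has to land in some target step \<open>r'\<close>.
\<close>

lemma continuous_map_inductive_limit:
  assumes X: "linear_scale X" and Y: "linear_scale Y"
    and g: "complex_linear_on (\<Union>r\<in>{0<..}. X r) g"
    and bound: "\<And>r. r > 0 \<Longrightarrow> \<exists>r'>0. \<exists>C>0. \<forall>x\<in>X r. g x \<in> Y r' \<and> M r' (g x) \<le> C * N r x"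
  shows "continuous_map (inductive_limit X N) (inductive_limit Y M) g"
proof -
  let ?E = "\<Union>r\<in>{0<..}. X r" and ?F = "\<Union>r\<in>{0<..}. Y r"
  have into: "g x \<in> ?F" if "x \<in> ?E" for x using that bound by fastforce
  have topX: "topspace (inductive_limit X N) = ?E"
    using linear_scaleD(1)[OF X] by (rule topspace_inductive_limit)
  have topY: "topspace (inductive_limit Y M) = ?F"
    using linear_scaleD(1)[OF Y] by (rule topspace_inductive_limit)
  have zero: "(\<lambda>_. 0) \<in> ?E" using linear_scaleD(1)[OF X, of 1] by force
  have g0: "g (\<lambda>_. 0) = (\<lambda>_. 0)" by (rule complex_linear_on_zero[OF g zero])
  show ?thesis
    unfolding continuous_map_def topX topY
  proof (intro conjI allI impI)
    show "g \<in> ?E \<rightarrow> ?F" using into by blast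
    fix U assume U: "openin (inductive_limit Y M) U"
    show "openin (inductive_limit X N) {x \<in> ?E. g x \<in> U}"
      unfolding openin_inductive_limit_iff
    proof (intro conjI ballI)
      fix x assume x: "x \<in> {x \<in> ?E. g x \<in> U}"
      then have "g x \<in> U" by simp
      then obtain V where V: "zero_neighbourhood Y M V"
        "\<forall>y\<in>?F. (\<lambda>i. y i - g x i) \<in> V \<longrightarrow> y \<in> U"
        using U unfolding openin_inductive_limit_iff by blast
      define V' where "V' = {x \<in> ?E. g x \<in> V}"
      have "absolutely_convex V" using V(1) by (simp add: zero_neighbourhood_def)
      have "absolutely_convex V'"
        unfolding absolutely_convex_def
      proof (intro ballI allI impI)
        fix u v and a b :: complex assume uv: "u \<in> V'" "v \<in> V'" and ab: "norm a + norm b \<le> 1"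
        have "g (\<lambda>i. a * u i + b * v i) = (\<lambda>j. a * g u j + b * g v j)"
          using g uv unfolding complex_linear_on_def V'_def by blast
        moreover have "(\<lambda>j. a * g u j + b * g v j) \<in> V"
          using \<open>absolutely_convex V\<close> uv ab unfolding absolutely_convex_def V'_def by blast
        ultimately show "(\<lambda>i. a * u i + b * v i) \<in> V'"
          using linear_scale_Union[OF X] uv unfolding V'_def by simp
      qed
      moreover have "\<exists>W. openin (quasinorm_topology (X r) (N r)) W \<and> (\<lambda>_. 0) \<in> W \<and> W \<subseteq> V'"
        if r: "r > 0" for r
      proof -
        obtain r' C where r': "r' > 0" "C > 0" "\<And>x. x \<in> X r \<Longrightarrow> g x \<in> Y r' \<and> M r' (g x) \<le> C * N r x"
          using bound[OF r] by blast
        obtain W where W: "openin (quasinorm_topology (Y r') (M r')) W" "(\<lambda>_. 0) \<in> W" "W \<subseteq> V"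
          using V(1) r'(1) unfolding zero_neighbourhood_def by blast
        have "openin (quasinorm_topology (X r) (N r)) {x \<in> X r. g x \<in> W}"
          using openin_preimage_step[OF X r _ g r'(2) r'(3) W(1)] r by blast
        moreover have "(\<lambda>_. 0) \<in> {x \<in> X r. g x \<in> W}"
          using linear_scaleD(1)[OF X r] g0 W(2) by simp
        moreover have "{x \<in> X r. g x \<in> W} \<subseteq> V'" using W(3) r unfolding V'_def by auto
        ultimately show ?thesis by blast
      qed
      moreover have "y \<in> {x \<in> ?E. g x \<in> U}" if y: "y \<in> ?E" "(\<lambda>i. y i - x i) \<in> V'" for y
      proof -
        have "g (\<lambda>i. y i - x i) = (\<lambda>i. g y i - g x i)"
          using complex_linear_on_diff[OF g] x y(1) by blast
        then show ?thesis using V(2)[rule_format, OF into[OF y(1)]] y unfolding V'_def by simp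
      qed
      ultimately show "\<exists>V. zero_neighbourhood X N V \<and>
        (\<forall>y\<in>?E. (\<lambda>i. y i - x i) \<in> V \<longrightarrow> y \<in> {x \<in> ?E. g x \<in> U})"
        unfolding zero_neighbourhood_def by blast
    qed auto
  qed
qed

lemma openin_evaluation_preimage:
  assumes C: "C > 0" and bound: "\<And>x y. x \<in> X \<Longrightarrow> y \<in> X \<Longrightarrow> norm (y z - x z) \<le> C * N (\<lambda>i. y i - x i)"
    and S: "open (S :: complex set)"
  shows "openin (quasinorm_topology X N) {x \<in> X. x z \<in> S}"
  unfolding openin_quasinorm_topology
proof (intro conjI ballI)
  fix x assume x: "x \<in> {x \<in> X. x z \<in> S}"
  then obtain e where e: "e > 0" "\<And>w. dist w (x z) < e \<Longrightarrow> w \<in> S"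
    using S unfolding open_dist by blast
  have "y \<in> {x \<in> X. x z \<in> S}" if y: "y \<in> X" "N (\<lambda>i. y i - x i) < e / C" for y
  proof -
    have "norm (y z - x z) \<le> C * N (\<lambda>i. y i - x i)" using bound x y(1) by simp
    also have "\<dots> < e" using y(2) C by (simp add: pos_less_divide_eq mult.commute)
    finally show ?thesis using e(2)[of "y z"] y(1) by (simp add: dist_norm)
  qed
  then show "\<exists>\<epsilon>>0. \<forall>y\<in>X. N (\<lambda>i. y i - x i) < \<epsilon> \<longrightarrow> y \<in> {x \<in> X. x z \<in> S}"
    using e(1) C by (intro exI[of _ "e / C"]) simp
qed auto

lemma continuous_map_evaluation_projective:
  assumes X: "linear_scale X"
    and bound: "\<And>r. r > 0 \<Longrightarrow> \<exists>C>0. \<forall>x\<in>X r. norm (x z) \<le> C * N r x"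
  shows "continuous_map (projective_limit X N) euclidean (\<lambda>x. x z :: complex)"
proof -
  obtain C where C: "C > 0" "\<And>x. x \<in> X 1 \<Longrightarrow> norm (x z) \<le> C * N 1 x"
    using bound[of 1] by auto
  have "norm (y z - x z) \<le> C * N 1 (\<lambda>i. y i - x i)" if "x \<in> X 1" "y \<in> X 1" for x y
    using C(2)[OF linear_scale_diff[OF X zero_less_one that(2,1)]] .
  then have "openin (quasinorm_topology (X 1) (N 1)) {x \<in> X 1. x z \<in> S}" if "open S" for S
    using that by (intro openin_evaluation_preimage[where C = C and N = "N 1"] C(1))
  then have "openin (projective_limit X N) ((\<Inter>t\<in>{0<..}. X t) \<inter> {x \<in> X 1. x z \<in> S})" if "open S" for S
    unfolding projective_limit_def using that zero_less_one
    by (intro topology_generated_by_Basis) blast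
  moreover have "(\<Inter>t\<in>{0<..}. X t) \<inter> {x \<in> X 1. x z \<in> S} = {x \<in> (\<Inter>t\<in>{0<..}. X t). x z \<in> S}" for S
    by auto
  ultimately show ?thesis unfolding continuous_map_def by simp
qed

lemma continuous_map_evaluation_inductive:
  assumes X: "linear_scale X"
    and bound: "\<And>r. r > 0 \<Longrightarrow> \<exists>C>0. \<forall>x\<in>X r. norm (x z) \<le> C * N r x"
  shows "continuous_map (inductive_limit X N) euclidean (\<lambda>x. x z :: complex)"
proof -
  have topX: "topspace (inductive_limit X N) = (\<Union>r\<in>{0<..}. X r)"
    using linear_scaleD(1)[OF X] by (rule topspace_inductive_limit)
  have "openin (inductive_limit X N) {x \<in> (\<Union>r\<in>{0<..}. X r). x z \<in> S}" if S: "open S" for S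
    unfolding openin_inductive_limit_iff
  proof (intro conjI ballI)
    fix x assume x: "x \<in> {x \<in> (\<Union>r\<in>{0<..}. X r). x z \<in> S}"
    then obtain e where e: "e > 0" "\<And>w. dist w (x z) < e \<Longrightarrow> w \<in> S"
      using S unfolding open_dist by blast
    define V where "V = {y :: 'a \<Rightarrow> complex. y z \<in> ball 0 e}"
    have "absolutely_convex V"
      unfolding absolutely_convex_def V_def
    proof (clarsimp)
      fix u v :: "'a \<Rightarrow> complex" and a b :: complex
      assume uv: "norm (u z) < e" "norm (v z) < e" and ab: "norm a + norm b \<le> 1"
      define m where "m = max (norm (u z)) (norm (v z))"
      have "norm (a * u z + b * v z) \<le> norm a * norm (u z) + norm b * norm (v z)"
        using norm_triangle_ineq[of "a * u z" "b * v z"] by (simp add: norm_mult)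
      also have "\<dots> \<le> norm a * m + norm b * m"
        unfolding m_def by (intro add_mono mult_left_mono) auto
      also have "\<dots> = (norm a + norm b) * m" by (simp add: ring_distribs)
      also have "\<dots> \<le> 1 * m" by (intro mult_right_mono ab) (simp add: m_def le_max_iff_disj)
      also have "\<dots> < e" using uv by (simp add: m_def)
      finally show "norm (a * u z + b * v z) < e" .
    qed
    moreover have "\<exists>W. openin (quasinorm_topology (X r) (N r)) W \<and> (\<lambda>_. 0) \<in> W \<and> W \<subseteq> V"
      if r: "r > 0" for r
    proof -
      obtain C where C: "C > 0" "\<And>x. x \<in> X r \<Longrightarrow> norm (x z) \<le> C * N r x"
        using bound[OF r] by auto
      have "norm (y z - x z) \<le> C * N r (\<lambda>i. y i - x i)" if "x \<in> X r" "y \<in> X r" for x y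
        using C(2)[OF linear_scale_diff[OF X r that(2,1)]] .
      then have "openin (quasinorm_topology (X r) (N r)) {x \<in> X r. x z \<in> ball 0 e}"
        by (intro openin_evaluation_preimage[where C = C and N = "N r"] C(1) open_ball)
      then show ?thesis using linear_scaleD(1)[OF X r] e(1)
        by (intro exI[of _ "{x \<in> X r. x z \<in> ball 0 e}"]) (auto simp: V_def)
    qed
    moreover have "y \<in> {x \<in> (\<Union>r\<in>{0<..}. X r). x z \<in> S}"
      if "y \<in> (\<Union>r\<in>{0<..}. X r)" "(\<lambda>i. y i - x i) \<in> V" for y
      using that e(2)[of "y z"] by (simp add: V_def dist_norm norm_minus_commute)
    ultimately show "\<exists>V. zero_neighbourhood X N V \<and>
        (\<forall>y\<in>(\<Union>r\<in>{0<..}. X r). (\<lambda>i. y i - x i) \<in> V \<longrightarrow> y \<in> {x \<in> (\<Union>r\<in>{0<..}. X r). x z \<in> S})"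
      unfolding zero_neighbourhood_def by blast
  qed auto
  then show ?thesis unfolding continuous_map_def topX by simp
qed

text \<open>
  Finite intersections and unions of basic open sets are handled by induction on how an open set is
  generated: the sequence is eventually in every open set that contains its limit.
\<close>

lemma closure_of_projective_limit:
  assumes x: "x \<in> (\<Inter>r\<in>{0<..}. X r)"
    and u: "\<And>n. u n \<in> D" "\<And>n. u n \<in> (\<Inter>r\<in>{0<..}. X r)"
    and lim: "\<And>r. r > 0 \<Longrightarrow> (\<lambda>n. N r (\<lambda>i. u n i - x i)) \<longlonglongrightarrow> 0"
  shows "x \<in> (projective_limit X N) closure_of D"
proof -
  have ev: "\<forall>\<^sub>F n in sequentially. u n \<in> T"
    if "generate_topology_on {(\<Inter>t\<in>{0<..}. X t) \<inter> U | r U.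
      r > 0 \<and> openin (quasinorm_topology (X r) (N r)) U} T" "x \<in> T" for T
    using that
  proof (induction rule: generate_topology_on.induct)
    case (Basis T)
    then obtain r U where r: "r > 0" and U: "openin (quasinorm_topology (X r) (N r)) U"
      and T: "T = (\<Inter>t\<in>{0<..}. X t) \<inter> U" by blast
    obtain e where e: "e > 0" "\<And>y. y \<in> X r \<Longrightarrow> N r (\<lambda>i. y i - x i) < e \<Longrightarrow> y \<in> U"
      using U[unfolded openin_quasinorm_topology, THEN conjunct2, THEN bspec, of x] Basis(2) T by auto
    have "\<forall>\<^sub>F n in sequentially. N r (\<lambda>i. u n i - x i) < e"
      using order_tendstoD(2)[OF lim[OF r] e(1)] .
    then show ?case
      by eventually_elim (use e(2) u(2) r in \<open>auto simp: T\<close>)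
  next
    case (Int S T)
    then show ?case by (auto simp: eventually_conj_iff)
  next
    case (UN K)
    then obtain S where "S \<in> K" "x \<in> S" by blast
    then have "\<forall>\<^sub>F n in sequentially. u n \<in> S" using UN by blast
    then show ?case by eventually_elim (use \<open>S \<in> K\<close> in blast)
  qed auto
  show ?thesis
    unfolding in_closure_of
  proof (intro conjI allI impI)
    show "x \<in> topspace (projective_limit X N)" using x by simp
    fix T assume "x \<in> T \<and> openin (projective_limit X N) T"
    then have "\<forall>\<^sub>F n in sequentially. u n \<in> T"
      by (intro ev) (simp_all add: projective_limit_def openin_topology_generated_by_iff)
    then obtain n where "u n \<in> T" by (meson eventually_happens' sequentially_bot)
    then show "\<exists>y. y \<in> D \<and> y \<in> T" using u(1) by blast
  qed
qed

text \<open>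
  Convergence in a single step suffices here, since each neighbourhood of zero contains an open set of
  that step.
\<close>

lemma closure_of_inductive_limit:
  assumes X: "linear_scale X" and r: "r > 0" and x: "x \<in> X r"
    and u: "\<And>n. u n \<in> D" "\<And>n. u n \<in> X r"
    and lim: "(\<lambda>n. N r (\<lambda>i. u n i - x i)) \<longlonglongrightarrow> 0"
  shows "x \<in> (inductive_limit X N) closure_of D"
  unfolding in_closure_of
proof (intro conjI allI impI)
  have topX: "topspace (inductive_limit X N) = (\<Union>r\<in>{0<..}. X r)"
    using linear_scaleD(1)[OF X] by (rule topspace_inductive_limit)
  then show "x \<in> topspace (inductive_limit X N)" using x r by auto
  fix T assume T: "x \<in> T \<and> openin (inductive_limit X N) T"
  then obtain V where V: "zero_neighbourhood X N V"
    "\<forall>y\<in>(\<Union>r\<in>{0<..}. X r). (\<lambda>i. y i - x i) \<in> V \<longrightarrow> y \<in> T"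
    unfolding openin_inductive_limit_iff by blast
  obtain W where W: "openin (quasinorm_topology (X r) (N r)) W" "(\<lambda>_. 0) \<in> W" "W \<subseteq> V"
    using V(1) r unfolding zero_neighbourhood_def by blast
  obtain e where e: "e > 0" "\<And>y. y \<in> X r \<Longrightarrow> N r (\<lambda>i. y i - 0) < e \<Longrightarrow> y \<in> W"
    using W(1)[unfolded openin_quasinorm_topology, THEN conjunct2, THEN bspec, OF W(2)] by auto
  have "\<forall>\<^sub>F n in sequentially. N r (\<lambda>i. u n i - x i) < e"
    using order_tendstoD(2)[OF lim e(1)] .
  then obtain n where n: "N r (\<lambda>i. u n i - x i) < e" by (meson eventually_happens' sequentially_bot)
  have "(\<lambda>i. u n i - x i) \<in> W"
    using e(2)[OF linear_scale_diff[OF X r u(2) x]] n by simp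
  then have "u n \<in> T" using V(2) W(3) u(2)[of n] r by auto
  then show "\<exists>y. y \<in> D \<and> y \<in> T" using u(1) by blast
qed

text \<open>
  Composed with a point evaluation, two homeomorphic extensions become continuous maps into \<open>\<complex>\<close> that
  coincide on a dense set.
\<close>

lemma extends_uniquely_to_homeomorphismI:
  fixes f g :: "'a \<Rightarrow> 'j \<Rightarrow> complex"
  assumes D: "D \<subseteq> topspace X" and dense: "topspace X \<subseteq> X closure_of D"
    and g: "homeomorphic_map X Y g" "\<And>x. x \<in> D \<Longrightarrow> g x = f x"
    and ev: "\<And>z. continuous_map Y euclidean (\<lambda>y. y z)"
  shows "extends_uniquely_to_homeomorphism f D X Y"
  unfolding extends_uniquely_to_homeomorphism_def
proof (intro conjI ex1I[of _ "restrict g (topspace X)"])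
  show "homeomorphic_map X Y (restrict g (topspace X))"
    using g(1) by (rule homeomorphic_map_eq) simp
  show "\<forall>x\<in>D. restrict g (topspace X) x = f x" using D g(2) by auto
  fix h assume h: "h \<in> extensional (topspace X) \<and> homeomorphic_map X Y h \<and> (\<forall>x\<in>D. h x = f x)"
  show "h = restrict g (topspace X)"
  proof (rule extensionalityI[where A = "topspace X"])
    fix x assume x: "x \<in> topspace X"
    have "h x z = g x z" for z
    proof (rule forall_in_closure_of_eq[where X = X and Y = euclidean and S = D])
      show "continuous_map X euclidean (\<lambda>x. h x z)"
        using continuous_map_compose[OF homeomorphic_imp_continuous_map ev, of X h] h
        by (simp add: o_def)
      show "continuous_map X euclidean (\<lambda>x. g x z)"
        using continuous_map_compose[OF homeomorphic_imp_continuous_map[OF g(1)] ev]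
        by (simp add: o_def)
    qed (use x dense h g(2) in auto)
    then show "h x = restrict g (topspace X) x" using x by auto
  qed (use h in auto)
qed (use D in auto)


section \<open>Entire functions of several variables\<close>

lemma entireI:
  assumes "\<And>z. \<exists>D. (F has_derivative D) (at z) \<and> (\<forall>c v. D (c *s v) = c * D v)"
  shows "F \<in> entire"
  using assms by (simp add: entire_def)

lemma entireE:
  assumes "F \<in> entire"
  obtains D where "(F has_derivative D) (at z)" "\<And>c v. D (c *s v) = c * D v"
  using assms unfolding entire_def by blast

lemma entire_imp_continuous:
  assumes "F \<in> entire"
  shows "continuous_on S F"
proof -
  have "continuous (at z) F" for z
    using assms by (rule entireE) (rule has_derivative_continuous)
  then show ?thesis by (simp add: continuous_at_imp_continuous_on)
qed

lemma entire_const: "(\<lambda>_. c) \<in> entire"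
  by (intro entireI exI[of _ "\<lambda>_. 0"]) simp

lemma entire_coordinate: "(\<lambda>z. z $ i) \<in> entire"
  by (intro entireI exI[of _ "\<lambda>v. v $ i"])
    (simp add: bounded_linear_imp_has_derivative bounded_linear_vec_nth)

lemma entire_linear_combination:
  assumes "F \<in> entire" "G \<in> entire"
  shows "(\<lambda>z. a * F z + b * G z) \<in> entire"
proof (rule entireI)
  fix z
  obtain D where D: "(F has_derivative D) (at z)" "\<And>c v. D (c *s v) = c * D v"
    using entireE[OF assms(1)] by blast
  obtain E where E: "(G has_derivative E) (at z)" "\<And>c v. E (c *s v) = c * E v"
    using entireE[OF assms(2)] by blast
  have "((\<lambda>z. a * F z + b * G z) has_derivative (\<lambda>v. a * D v + b * E v)) (at z)"
    by (intro derivative_intros D E)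
  then show "\<exists>D. ((\<lambda>z. a * F z + b * G z) has_derivative D) (at z) \<and> (\<forall>c v. D (c *s v) = c * D v)"
    by (intro exI conjI) (auto simp: D E algebra_simps)
qed

lemma entire_cmult: "F \<in> entire \<Longrightarrow> (\<lambda>z. a * F z) \<in> entire"
  using entire_linear_combination[of F F a 0] by simp

lemma entire_diff: "F \<in> entire \<Longrightarrow> G \<in> entire \<Longrightarrow> (\<lambda>z. F z - G z) \<in> entire"
  using entire_linear_combination[of F G 1 "-1"] by simp

lemma entire_sum: "(\<And>i. i \<in> A \<Longrightarrow> F i \<in> entire) \<Longrightarrow> (\<lambda>z. \<Sum>i\<in>A. F i z) \<in> entire"
proof (induction A rule: infinite_finite_induct)
  case (insert i A)
  then show ?case using entire_linear_combination[of "F i" "\<lambda>z. \<Sum>i\<in>A. F i z" 1 1] by simp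
qed (simp_all add: entire_const)

lemma entire_mult:
  assumes "F \<in> entire" "G \<in> entire"
  shows "(\<lambda>z. F z * G z) \<in> entire"
proof (rule entireI)
  fix z
  obtain D where D: "(F has_derivative D) (at z)" "\<And>c v. D (c *s v) = c * D v"
    using entireE[OF assms(1)] by blast
  obtain E where E: "(G has_derivative E) (at z)" "\<And>c v. E (c *s v) = c * E v"
    using entireE[OF assms(2)] by blast
  have "((\<lambda>z. F z * G z) has_derivative (\<lambda>v. F z * E v + D v * G z)) (at z)"
    by (intro has_derivative_mult D E)
  then show "\<exists>D. ((\<lambda>z. F z * G z) has_derivative D) (at z) \<and> (\<forall>c v. D (c *s v) = c * D v)"
    by (intro exI conjI) (auto simp: D E algebra_simps)
qed

lemma entire_power: "F \<in> entire \<Longrightarrow> (\<lambda>z. F z ^ n) \<in> entire"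
  by (induction n) (simp_all add: entire_const entire_mult)

lemma entire_prod: "(\<And>i. i \<in> A \<Longrightarrow> F i \<in> entire) \<Longrightarrow> (\<lambda>z. \<Prod>i\<in>A. F i z) \<in> entire"
  by (induction A rule: infinite_finite_induct) (simp_all add: entire_const entire_mult)

lemma entire_e_basis: "e_basis \<alpha> \<in> entire"
proof -
  have "(\<lambda>z. inverse (complex_of_real (sqrt (real (mi_fact \<alpha>)))) * mi_power z \<alpha>) \<in> entire"
    unfolding mi_power_def by (intro entire_cmult entire_prod entire_power entire_coordinate)
  then show ?thesis by (simp add: e_basis_def[abs_def] divide_inverse mult.commute)
qed

lemma entire_compose_linear:
  assumes F: "F \<in> entire" and L: "bounded_linear L" "\<And>c v. L (c *s v) = c *s L v"
  shows "(\<lambda>z. F (L z)) \<in> entire"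
proof (rule entireI)
  fix z
  obtain D where D: "(F has_derivative D) (at (L z))" "\<And>c v. D (c *s v) = c * D v"
    using entireE[OF F] by blast
  have "((\<lambda>z. F (L z)) has_derivative (\<lambda>v. D (L v))) (at z)"
    using has_derivative_compose[OF bounded_linear_imp_has_derivative[OF L(1)] D(1)] .
  then show "\<exists>D. ((\<lambda>z. F (L z)) has_derivative D) (at z) \<and> (\<forall>c v. D (c *s v) = c * D v)"
    by (intro exI conjI) (auto simp: D(2) L(2))
qed

lemma norm_vector_smult: "norm (c *s v) = norm c * norm (v :: complex ^ 'd)"
  by (simp add: norm_vec_def L2_set_right_distrib norm_mult)

lemma bounded_linear_smult_left: "bounded_linear (\<lambda>c. c *s (v :: complex ^ 'd))"
  by (rule bounded_linear_intro[of _ "norm v"])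
    (simp_all add: vec_eq_iff norm_vector_smult ring_distribs)

lemma entire_line_has_field_derivative:
  fixes v :: "complex ^ 'd"
  assumes "(F has_derivative D) (at (a + l *s v))" "\<And>c v. D (c *s v) = c * D v"
  shows "((\<lambda>l. F (a + l *s v)) has_field_derivative D v) (at l)"
proof -
  have "((\<lambda>l. a + l *s v) has_derivative (\<lambda>h. h *s v)) (at l)"
    using has_derivative_add[OF has_derivative_const[of a]
        bounded_linear_imp_has_derivative[OF bounded_linear_smult_left[of v]], of "at l"] by simp
  from has_derivative_compose[OF this assms(1)] show ?thesis
    by (simp add: has_field_derivative_def assms(2) mult.commute[of "D v"] mult_commute_abs)
qed

lemma entire_line_holomorphic:
  assumes "F \<in> entire"
  shows "(\<lambda>l. F (a + l *s v)) holomorphic_on S"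
proof -
  have "\<exists>d. ((\<lambda>l. F (a + l *s v)) has_field_derivative d) (at l)" for l
    using assms by (rule entireE) (blast intro: entire_line_has_field_derivative)
  then show ?thesis
    unfolding holomorphic_on_def field_differentiable_def by (blast intro: has_field_derivative_at_within)
qed

text \<open>Cauchy's inequality on the complex line through \<open>z\<close> in the direction \<open>h\<close>.\<close>

lemma entire_derivative_bound:
  assumes F: "F \<in> entire" and D: "(F has_derivative D) (at z)" "\<And>c v. D (c *s v) = c * D v"
    and B: "\<And>w. w \<in> cball z 1 \<Longrightarrow> norm (F w) \<le> B"
  shows "norm (D h) \<le> B * norm h"
proof (cases "h = 0")
  case True
  then show ?thesis using D(2)[of 0 0] by simp
next
  case False
  define v where "v = complex_of_real (1 / norm h) *s h"
  have v: "norm v = 1" using False by (simp add: v_def norm_vector_smult norm_divide)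
  have h: "h = complex_of_real (norm h) *s v" using False by (simp add: v_def vec_eq_iff)
  have "norm ((deriv ^^ 1) (\<lambda>l. F (z + l *s v)) 0) \<le> fact 1 * B / 1 ^ 1"
  proof (rule Cauchy_inequality)
    fix l :: complex assume "norm (0 - l) = 1"
    then show "norm (F (z + l *s v)) \<le> B"
      by (intro B) (simp add: dist_norm norm_vector_smult v)
  qed (use F in \<open>auto intro: entire_line_holomorphic holomorphic_on_imp_continuous_on\<close>)
  moreover have "deriv (\<lambda>l. F (z + l *s v)) 0 = D v"
    by (rule DERIV_imp_deriv, rule entire_line_has_field_derivative) (use D in simp_all)
  ultimately have "norm (D v) \<le> B" by simp
  moreover have "D h = complex_of_real (norm h) * D v" using D(2) h by metis
  ultimately show ?thesis using mult_right_mono[of "norm (D v)" B "norm h"]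
    by (simp add: norm_mult mult.commute[of "norm h"])
qed

text \<open>
  Weierstrass' theorem: by the preceding bound, uniform convergence on a ball forces uniform
  convergence of the derivatives on the concentric ball whose radius is smaller by one.
\<close>

lemma entire_uniform_limit:
  fixes f :: "nat \<Rightarrow> complex ^ 'd \<Rightarrow> complex"
  assumes f: "\<And>n. f n \<in> entire"
    and lim: "\<And>R. uniform_limit (cball 0 R) f G sequentially"
  shows "G \<in> entire"
proof (rule entireI)
  fix z :: "complex ^ 'd"
  define S where "S = cball z 1"
  obtain D where D: "\<And>n x. (f n has_derivative D n x) (at x)" "\<And>n x c v. D n x (c *s v) = c * D n x v"
    using f unfolding entire_def mem_Collect_eq by metis
  have lim': "uniform_limit (cball z 2) f G sequentially"
    by (rule uniform_limit_on_subset[OF lim[of "norm z + 2"]])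
      (use norm_triangle_ineq in \<open>fastforce simp: dist_norm norm_minus_commute
        intro: order_trans[OF norm_triangle_sub[of _ z]]\<close>)
  have cauchy: "\<exists>N. \<forall>m\<ge>N. \<forall>n\<ge>N. \<forall>x\<in>S. \<forall>h. norm (D m x h - D n x h) \<le> e * norm h" if e: "e > 0" for e
  proof -
    have "\<forall>\<^sub>F n in sequentially. \<forall>x\<in>cball z 2. dist (f n x) (G x) < e / 2"
      using e by (intro uniform_limitD[OF lim']) simp
    then obtain N where N: "\<And>n x. n \<ge> N \<Longrightarrow> x \<in> cball z 2 \<Longrightarrow> dist (f n x) (G x) < e / 2"
      unfolding eventually_sequentially by blast
    have "norm (D m x h - D n x h) \<le> e * norm h" if mn: "m \<ge> N" "n \<ge> N" and x: "x \<in> S" for m n x h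
    proof (rule entire_derivative_bound[where F = "\<lambda>w. f m w - f n w" and z = x])
      show "(\<lambda>w. f m w - f n w) \<in> entire" by (intro entire_diff f)
      show "((\<lambda>w. f m w - f n w) has_derivative (\<lambda>h. D m x h - D n x h)) (at x)"
        by (intro derivative_intros D)
      show "D m x (c *s v) - D n x (c *s v) = c * (D m x v - D n x v)" for c v
        by (simp add: D(2) algebra_simps)
      fix w assume "w \<in> cball x 1"
      then have w: "w \<in> cball z 2" using x dist_triangle[of z w x] by (simp add: S_def)
      have "dist (f m w) (f n w) < e / 2 + e / 2"
        by (rule dist_triangle_less_add[OF N[OF mn(1) w]]) (use N[OF mn(2) w] in \<open>simp add: dist_commute\<close>)
      then show "norm (f m w - f n w) \<le> e" by (simp add: dist_norm)
    qed
    then show ?thesis by blast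
  qed
  define D' where "D' x h = lim (\<lambda>n. D n x h)" for x h
  have D': "(\<lambda>n. D n x h) \<longlonglongrightarrow> D' x h" if x: "x \<in> S" for x h
  proof -
    have "Cauchy (\<lambda>n. D n x h)"
      unfolding Cauchy_def
    proof (intro allI impI)
      fix e :: real assume e: "e > 0"
      define e' where "e' = e / (norm h + 1)"
      have "e' > 0" using e by (simp add: e'_def add_nonneg_pos)
      then obtain N where N: "\<And>m n. m \<ge> N \<Longrightarrow> n \<ge> N \<Longrightarrow> norm (D m x h - D n x h) \<le> e' * norm h"
        using cauchy x by blast
      have "norm h + 1 > 0" by (simp add: add_nonneg_pos)
      then have "e' * norm h < e" using e by (simp add: e'_def pos_divide_less_eq algebra_simps)
      then show "\<exists>M. \<forall>m\<ge>M. \<forall>n\<ge>M. dist (D m x h) (D n x h) < e"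
        using N by (intro exI[of _ N]) (force simp: dist_norm)
    qed
    then show ?thesis unfolding D'_def by (simp add: Cauchy_convergent convergent_LIMSEQ_iff[symmetric])
  qed
  have "\<exists>g. \<forall>x\<in>S. (\<lambda>n. f n x) \<longlonglongrightarrow> g x \<and> (g has_derivative D' x) (at x within S)"
  proof (rule has_derivative_sequence)
    show "convex S" "z \<in> S" by (simp_all add: S_def)
    show "(f n has_derivative D n x) (at x within S)" for n x
      using D(1) by (rule has_derivative_at_withinI)
    show "(\<lambda>n. f n z) \<longlonglongrightarrow> G z"
      using tendsto_uniform_limitI[OF lim'] by simp
    fix e :: real assume "e > 0"
    then obtain N where N: "\<And>m n x h. m \<ge> N \<Longrightarrow> n \<ge> N \<Longrightarrow> x \<in> S \<Longrightarrow> norm (D m x h - D n x h) \<le> e * norm h"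
      using cauchy by blast
    have "norm (D n x h - D' x h) \<le> e * norm h" if "n \<ge> N" "x \<in> S" for n x h
    proof (rule tendsto_upperbound)
      show "(\<lambda>m. norm (D n x h - D m x h)) \<longlonglongrightarrow> norm (D n x h - D' x h)"
        by (intro tendsto_intros D' that)
      show "\<forall>\<^sub>F m in sequentially. norm (D n x h - D m x h) \<le> e * norm h"
        unfolding eventually_sequentially using N that by blast
    qed simp
    then show "\<forall>\<^sub>F n in sequentially. \<forall>x\<in>S. \<forall>h. norm (D n x h - D' x h) \<le> e * norm h"
      unfolding eventually_sequentially by blast
  qed
  then obtain g where g: "\<And>x. x \<in> S \<Longrightarrow> (\<lambda>n. f n x) \<longlonglongrightarrow> g x"
    "\<And>x. x \<in> S \<Longrightarrow> (g has_derivative D' x) (at x within S)" by blast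
  have "g x = G x" if "x \<in> S" for x
  proof (rule LIMSEQ_unique[OF g(1)[OF that]])
    show "(\<lambda>n. f n x) \<longlonglongrightarrow> G x"
      using tendsto_uniform_limitI[OF lim'] that by (simp add: S_def)
  qed
  moreover have "(g has_derivative D' z) (at z)"
  proof -
    have "at z within S = at z"
      unfolding S_def by (rule at_within_interior) (simp add: interior_cball)
    moreover have "z \<in> S" by (simp add: S_def)
    ultimately show ?thesis using g(2) by metis
  qed
  ultimately have "(G has_derivative D' z) (at z)"
    by (intro has_derivative_transform_within_open[of g "D' z" z UNIV "ball z 1" G])
      (simp_all add: S_def)
  moreover have "D' z (c *s v) = c * D' z v" for c v
  proof (rule LIMSEQ_unique)
    show "(\<lambda>n. D n z (c *s v)) \<longlonglongrightarrow> D' z (c *s v)" by (rule D') (simp add: S_def)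
    show "(\<lambda>n. D n z (c *s v)) \<longlonglongrightarrow> c * D' z v"
      unfolding D(2) by (rule tendsto_mult[OF tendsto_const D']) (simp add: S_def)
  qed
  ultimately show "\<exists>D. (G has_derivative D) (at z) \<and> (\<forall>c v. D (c *s v) = c * D v)" by blast
qed


section \<open>Taylor coefficients in one variable\<close>

definition taylor_coeff :: "nat \<Rightarrow> (complex \<Rightarrow> complex) \<Rightarrow> complex" where
  "taylor_coeff k f = (deriv ^^ k) f 0 / fact k"

lemma taylor_coeff_sums:
  assumes "f holomorphic_on UNIV"
  shows "(\<lambda>k. taylor_coeff k f * l ^ k) sums f l"
  using holomorphic_power_series[of f 0 "norm l + 1" l] holomorphic_on_subset[OF assms]
  by (simp add: taylor_coeff_def)

lemma taylor_coeff_unique: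
  assumes "\<And>l. (\<lambda>k. d k * l ^ k) sums f l"
  shows "taylor_coeff k f = d k"
proof -
  have "f has_fps_expansion Abs_fps d"
    by (rule has_fps_expansionI) (simp add: assms)
  then show ?thesis using fps_nth_fps_expansion[of f "Abs_fps d" k] by (simp add: taylor_coeff_def)
qed

lemma taylor_coeff_cmult:
  assumes "f holomorphic_on UNIV"
  shows "taylor_coeff k (\<lambda>l. c * f l) = c * taylor_coeff k f"
  by (rule taylor_coeff_unique)
    (use sums_mult[OF taylor_coeff_sums[OF assms], of c] in \<open>simp add: mult.assoc\<close>)

lemma taylor_coeff_rescale:
  assumes "f holomorphic_on UNIV"
  shows "taylor_coeff k (\<lambda>l. f (c * l)) = c ^ k * taylor_coeff k f"
proof (rule taylor_coeff_unique)
  show "(\<lambda>m. c ^ m * taylor_coeff m f * l ^ m) sums f (c * l)" for l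
    using taylor_coeff_sums[OF assms, of "c * l"] by (simp add: power_mult_distrib mult.left_commute mult.assoc)
qed

lemma taylor_coeff_bound:
  assumes "f holomorphic_on UNIV" "t > 0" "\<And>l. norm l = t \<Longrightarrow> norm (f l) \<le> M"
  shows "norm (taylor_coeff k f) * t ^ k \<le> M"
proof -
  have "norm ((deriv ^^ k) f 0) \<le> fact k * M / t ^ k"
    by (rule Cauchy_inequality)
      (use assms in \<open>auto intro: holomorphic_on_imp_continuous_on holomorphic_on_subset\<close>)
  then show ?thesis
    using assms(2) by (simp add: taylor_coeff_def norm_divide divide_simps mult_ac)
qed

text \<open>
  Dividing the remainder of order \<open>k\<close> by \<open>h ^ k\<close> leaves a power series whose constant term is the \<open>k\<close>-th
  coefficient and whose other terms are at most \<open>M * norm h * (1 / 2) ^ m\<close> by Cauchy's inequality. The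
  error depends on \<open>f\<close> only through \<open>M\<close>, which is what makes limits over \<open>h\<close> uniform in parameters.
\<close>

lemma taylor_coeff_difference_quotient:
  assumes f: "f holomorphic_on UNIV" and M: "\<And>l. norm l = 1 \<Longrightarrow> norm (f l) \<le> M"
    and h: "h \<noteq> 0" "norm h \<le> 1 / 2"
  shows "norm ((f h - (\<Sum>m<k. taylor_coeff m f * h ^ m)) / h ^ k - taylor_coeff k f) \<le> 2 * M * norm h"
proof -
  have bound: "norm (taylor_coeff m f) \<le> M" for m
    using taylor_coeff_bound[OF f zero_less_one M] by simp
  have "(\<lambda>m. taylor_coeff (m + k) f * h ^ (m + k)) sums (f h - (\<Sum>m<k. taylor_coeff m f * h ^ m))"
    by (rule sums_split_initial_segment[OF taylor_coeff_sums[OF f]])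
  from sums_divide[OF this, of "h ^ k"]
  have "(\<lambda>m. taylor_coeff (m + k) f * h ^ m) sums ((f h - (\<Sum>m<k. taylor_coeff m f * h ^ m)) / h ^ k)"
    using h(1) by (simp add: power_add)
  from sums_split_initial_segment[OF this, of 1]
  have *: "(\<lambda>m. taylor_coeff (m + 1 + k) f * h ^ (m + 1)) sums
      ((f h - (\<Sum>m<k. taylor_coeff m f * h ^ m)) / h ^ k - taylor_coeff k f)" by simp
  have **: "(\<lambda>m. M * norm h * (1 / 2) ^ m) sums (M * norm h * 2)"
    using sums_mult[OF geometric_sums[of "1 / 2 :: real"], of "M * norm h"] by simp
  have "norm (taylor_coeff (m + 1 + k) f * h ^ (m + 1)) \<le> M * norm h * (1 / 2) ^ m" for m
  proof -
    have "norm (taylor_coeff (m + 1 + k) f * h ^ (m + 1)) =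
        norm (taylor_coeff (m + 1 + k) f) * (norm h * norm h ^ m)"
      by (simp add: norm_mult norm_power)
    also have "\<dots> \<le> M * (norm h * (1 / 2) ^ m)"
      by (intro mult_mono bound power_mono h(2) mult_nonneg_nonneg order_refl)
        (use order_trans[OF norm_ge_zero bound] in auto)
    finally show ?thesis by (simp add: mult_ac)
  qed
  from norm_sums_le[OF * ** this] show ?thesis by (simp add: mult_ac)
qed


section \<open>Homogeneous parts in a coordinate\<close>

definition scale_coord :: "'d \<Rightarrow> complex \<Rightarrow> complex ^ 'd \<Rightarrow> complex ^ 'd" where
  "scale_coord j l z = (\<chi> i. if i = j then l * z $ i else z $ i)"

text \<open>
  For \<open>F = \<Sum>\<^sub>\<alpha> a\<^sub>\<alpha> z\<^sup>\<alpha>\<close> this is the sum of the terms in which \<open>z\<^sub>j\<close> occurs with exponent \<open>k\<close>. Keeping the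
  factor \<open>z\<^sub>j ^ k\<close>, instead of passing to a function of the other coordinates, makes it an operator on
  entire functions of the same variables.
\<close>

definition hom_part ::
    "'d \<Rightarrow> nat \<Rightarrow> (complex ^ 'd \<Rightarrow> complex) \<Rightarrow> complex ^ 'd \<Rightarrow> complex" where
  "hom_part j k F z = taylor_coeff k (\<lambda>l. F (scale_coord j l z))"

lemma scale_coord_nth: "scale_coord j l z $ i = (if i = j then l * z $ i else z $ i)"
  by (simp add: scale_coord_def)

lemma scale_coord_scale_coord: "scale_coord j l (scale_coord j c z) = scale_coord j (c * l) z"
  by (simp add: vec_eq_iff scale_coord_nth)

lemma scale_coord_commute:
  "i \<noteq> j \<Longrightarrow> scale_coord j l (scale_coord i c z) = scale_coord i c (scale_coord j l z)"
  by (simp add: vec_eq_iff scale_coord_nth)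

lemma scale_coord_one: "scale_coord j 1 z = z"
  by (simp add: vec_eq_iff scale_coord_nth)

lemma norm_scale_coord_le:
  assumes "norm l \<le> t" "t \<ge> 1"
  shows "norm (scale_coord j l z) \<le> t * norm z"
proof -
  have "norm (scale_coord j l z) \<le> norm (t *\<^sub>R z)"
  proof (rule norm_le_componentwise_cart)
    fix i
    show "norm (scale_coord j l z $ i) \<le> norm ((t *\<^sub>R z) $ i)"
      using mult_right_mono[OF assms(1), of "norm (z $ i)"] mult_right_mono[OF assms(2), of "norm (z $ i)"]
        assms by (auto simp: scale_coord_nth norm_mult)
  qed
  then show ?thesis using assms by simp
qed

lemma entire_scale_coord:
  assumes "F \<in> entire"
  shows "(\<lambda>z. F (scale_coord j l z)) \<in> entire"
proof (rule entire_compose_linear[OF assms])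
  show "bounded_linear (scale_coord j l)"
    by (rule linear_conv_bounded_linear[THEN iffD1], rule linearI)
      (simp_all add: vec_eq_iff scale_coord_nth algebra_simps)
qed (simp add: vec_eq_iff scale_coord_nth algebra_simps)

lemma scale_coord_holomorphic:
  assumes "F \<in> entire"
  shows "(\<lambda>l. F (scale_coord j l z)) holomorphic_on S"
proof -
  have "scale_coord j l z = (z - axis j (z $ j)) + l *s axis j (z $ j)" for l
    by (simp add: vec_eq_iff scale_coord_nth axis_def)
  then show ?thesis by (simp only: entire_line_holomorphic[OF assms])
qed

lemma entire_bounded_on_cball:
  assumes "F \<in> entire"
  obtains M where "\<And>z. norm z \<le> R \<Longrightarrow> norm (F z) \<le> M" "M > 0"
proof -
  have "bounded (F ` cball 0 R)"
    by (intro compact_imp_bounded compact_continuous_image entire_imp_continuous assms compact_cball)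
  then obtain b where "b > 0" "\<forall>x\<in>F ` cball 0 R. norm x \<le> b"
    unfolding bounded_pos by blast
  then show ?thesis by (intro that[of b]) auto
qed

text \<open>
  The \<open>k\<close>-th part is the limit of difference quotients in the scaling parameter, formed with the
  parts of lower order; the limit is locally uniform, so Weierstrass' theorem applies.
\<close>

lemma entire_hom_part:
  fixes F :: "complex ^ 'd \<Rightarrow> complex"
  assumes F: "F \<in> entire"
  shows "hom_part j k F \<in> entire"
proof (induction k rule: less_induct)
  case (less k)
  (* The shift by 2 keeps h within the radius 1/2 that the difference quotient estimate needs. *)
  define h where "h n = complex_of_real (1 / real (n + 2))" for n :: nat
  have h: "h n \<noteq> 0" "norm (h n) = 1 / real (n + 2)" for n
    unfolding h_def norm_of_real by (simp_all del: of_real_divide of_real_add)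
  define f where "f n z = (F (scale_coord j (h n) z) - (\<Sum>m<k. hom_part j m F z * h n ^ m)) / h n ^ k"
    for n z
  show ?case
  proof (rule entire_uniform_limit)
    have parts: "(\<lambda>z. hom_part j m F z * h n ^ m) \<in> entire" if "m < k" for m n
      using entire_mult[OF less[OF that] entire_const] .
    show "f n \<in> entire" for n
      unfolding f_def divide_inverse
      by (intro entire_mult[OF entire_diff[OF entire_scale_coord[OF F] entire_sum] entire_const] parts) simp
    fix R
    obtain M where M: "\<And>z. norm z \<le> R \<Longrightarrow> norm (F z) \<le> M" "M > 0"
      using entire_bounded_on_cball[of F R, OF F] by metis
    show "uniform_limit (cball 0 R) f (hom_part j k F) sequentially"
    proof (rule uniform_limitI)
      fix e :: real assume e: "e > 0"
      have "(\<lambda>n. 2 * M * (1 / real (n + 2))) \<longlonglongrightarrow> 0" by real_asymp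
      then have "\<forall>\<^sub>F n in sequentially. 2 * M * (1 / real (n + 2)) < e"
        using e by (rule order_tendstoD(2))
      then show "\<forall>\<^sub>F n in sequentially. \<forall>z\<in>cball 0 R. dist (f n z) (hom_part j k F z) < e"
      proof (eventually_elim, intro ballI)
        fix n z assume n: "2 * M * (1 / real (n + 2)) < e" and z: "z \<in> cball (0 :: complex ^ 'd) R"
        have "norm ((F (scale_coord j (h n) z) - (\<Sum>m<k. hom_part j m F z * h n ^ m)) / h n ^ k
            - hom_part j k F z) \<le> 2 * M * norm (h n)"
          unfolding hom_part_def
        proof (rule taylor_coeff_difference_quotient)
          show "norm (F (scale_coord j l z)) \<le> M" if "norm l = 1" for l
            using norm_scale_coord_le[of l 1 j z] z that by (intro M) simp
        qed (simp_all add: h scale_coord_holomorphic F)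
        then show "dist (f n z) (hom_part j k F z) < e"
          using n by (simp add: f_def dist_norm h(2))
      qed
    qed
  qed
qed

lemma hom_part_bound:
  assumes "F \<in> entire" "t > 0" "\<And>l. norm l = t \<Longrightarrow> norm (F (scale_coord j l z)) \<le> M"
  shows "norm (hom_part j k F z) * t ^ k \<le> M"
  unfolding hom_part_def using assms by (intro taylor_coeff_bound scale_coord_holomorphic)

text \<open>
  This is the Taylor series in the scaling parameter, evaluated at \<open>1\<close>; Cauchy's inequality on the circle
  of radius \<open>2\<close> makes it absolutely convergent, hence summable in any order.
\<close>

lemma hom_part_has_sum:
  assumes F: "F \<in> entire"
  shows "((\<lambda>k. hom_part j k F z) has_sum F z) UNIV"
proof (rule norm_summable_imp_has_sum)
  show "(\<lambda>k. hom_part j k F z) sums F z"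
    using taylor_coeff_sums[OF scale_coord_holomorphic[OF F], of j z 1]
    by (simp add: hom_part_def scale_coord_one)
  obtain M where M: "\<And>w. norm w \<le> 2 * norm z \<Longrightarrow> norm (F w) \<le> M"
    using entire_bounded_on_cball[of F "2 * norm z", OF F] by metis
  have "norm (hom_part j k F z) * 2 ^ k \<le> M" for k
    by (rule hom_part_bound[OF F]) (auto intro!: M norm_scale_coord_le)
  then have "norm (norm (hom_part j k F z)) \<le> M * (1 / 2) ^ k" for k
    by (simp add: divide_simps)
  moreover have "summable (\<lambda>k. M * (1 / 2) ^ k)" by (intro summable_mult summable_geometric) simp
  ultimately show "summable (\<lambda>k. norm (hom_part j k F z))" by (rule summable_comparison_test'[rotated])
qed

lemma hom_part_scale_coord:
  assumes "F \<in> entire"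
  shows "hom_part j k F (scale_coord j c z) = c ^ k * hom_part j k F z"
  unfolding hom_part_def scale_coord_scale_coord
  using taylor_coeff_rescale[OF scale_coord_holomorphic[OF assms, of j z], of k c] by simp

lemma hom_part_scale_other_coord:
  assumes "F \<in> entire" "i \<noteq> j" "\<And>z. F (scale_coord i c z) = c ^ m * F z"
  shows "hom_part j k F (scale_coord i c z) = c ^ m * hom_part j k F z"
proof -
  have "F (scale_coord j l (scale_coord i c z)) = c ^ m * F (scale_coord j l z)" for l
    using assms(3) scale_coord_commute[OF assms(2)] by metis
  then show ?thesis
    using taylor_coeff_cmult[OF scale_coord_holomorphic[OF assms(1), of j z], of k "c ^ m"]
    by (simp add: hom_part_def)
qed


section \<open>Sums over multi-indices\<close>

text \<open>
  A finite set of multi-indices lies in a cube, over which the sum factorises.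
\<close>

lemma sum_multi_index_prod_le:
  fixes f :: "'d::finite \<Rightarrow> nat \<Rightarrow> real"
  assumes f: "\<And>i k. f i k \<ge> 0" "\<And>i. summable (f i)" and A: "finite A"
  shows "(\<Sum>\<alpha>\<in>A. \<Prod>i\<in>UNIV. f i (\<alpha> $ i)) \<le> (\<Prod>i\<in>UNIV. suminf (f i))"
proof -
  define B where "B = (\<Union>\<alpha>\<in>A. range (($) \<alpha>))"
  have B: "finite B" unfolding B_def using A by simp
  have "(\<Sum>\<alpha>\<in>A. \<Prod>i\<in>UNIV. f i (\<alpha> $ i)) = (\<Sum>g\<in>($) ` A. \<Prod>i\<in>UNIV. f i (g i))"
    by (subst sum.reindex) (auto simp: inj_on_def vec_eq_iff fun_eq_iff)
  also have "\<dots> \<le> (\<Sum>g\<in>PiE UNIV (\<lambda>_. B). \<Prod>i\<in>UNIV. f i (g i))"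
    by (intro sum_mono2 finite_PiE prod_nonneg) (auto simp: f B, auto simp: B_def)
  also have "\<dots> = (\<Prod>i\<in>UNIV. \<Sum>k\<in>B. f i k)"
    by (rule prod_sum_PiE[symmetric]) (simp_all add: B)
  also have "\<dots> \<le> (\<Prod>i\<in>UNIV. suminf (f i))"
    by (intro prod_mono conjI sum_nonneg sum_le_suminf f B)
  finally show ?thesis .
qed

lemma summable_multi_index_prod:
  fixes f :: "'d::finite \<Rightarrow> nat \<Rightarrow> real"
  assumes "\<And>i k. f i k \<ge> 0" "\<And>i. summable (f i)"
  shows "(\<lambda>\<alpha>. \<Prod>i\<in>UNIV. f i (\<alpha> $ i)) summable_on UNIV"
proof (rule nonneg_bdd_above_summable_on)
  show "bdd_above (sum (\<lambda>\<alpha>. \<Prod>i\<in>UNIV. f i (\<alpha> $ i)) ` {F. F \<subseteq> UNIV \<and> finite F})"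
    using sum_multi_index_prod_le[OF assms] by (intro bdd_aboveI[of _ "\<Prod>i\<in>UNIV. suminf (f i)"]) auto
qed (simp add: assms prod_nonneg)

lemma finite_mi_length_le: "finite {\<alpha> :: nat ^ 'd::finite. mi_length \<alpha> \<le> n}"
proof -
  have "($) ` {\<alpha> :: nat ^ 'd. mi_length \<alpha> \<le> n} \<subseteq> PiE UNIV (\<lambda>_. {..n})"
  proof clarify
    fix \<alpha> :: "nat ^ 'd" assume \<alpha>: "mi_length \<alpha> \<le> n"
    have "\<alpha> $ i \<le> n" for i
      using member_le_sum[of i UNIV "($) \<alpha>"] \<alpha> by (simp add: mi_length_def)
    then show "($) \<alpha> \<in> PiE UNIV (\<lambda>_. {..n})" by auto
  qed
  then have "finite (($) ` {\<alpha> :: nat ^ 'd. mi_length \<alpha> \<le> n})"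
    by (rule finite_subset) (simp add: finite_PiE)
  then show ?thesis by (rule finite_imageD) (simp add: inj_on_def vec_eq_iff fun_eq_iff)
qed


section \<open>Taylor expansion in several variables\<close>

fun hom_parts ::
    "'d list \<Rightarrow> nat ^ 'd \<Rightarrow> (complex ^ 'd \<Rightarrow> complex) \<Rightarrow> complex ^ 'd \<Rightarrow> complex" where
  "hom_parts [] \<alpha> F = F"
| "hom_parts (j # js) \<alpha> F = hom_part j (\<alpha> $ j) (hom_parts js \<alpha> F)"

lemma entire_hom_parts: "F \<in> entire \<Longrightarrow> hom_parts js \<alpha> F \<in> entire"
  by (induction js) (simp_all add: entire_hom_part)

lemma hom_parts_cong:
  "(\<And>i. i \<in> set js \<Longrightarrow> \<alpha> $ i = \<beta> $ i) \<Longrightarrow> hom_parts js \<alpha> F = hom_parts js \<beta> F"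
  by (induction js) auto

text \<open>
  One application of Cauchy's inequality per coordinate. In the induction a coordinate that is still
  to be processed must not be enlarged, since it is scaled by \<open>t\<close> exactly once; hence the factor \<open>1\<close> off
  \<open>set js\<close>.
\<close>

lemma hom_parts_bound:
  fixes F :: "complex ^ 'd \<Rightarrow> complex"
  assumes F: "F \<in> entire" and t: "t > 0" and js: "distinct js"
    and M: "\<And>w :: complex ^ 'd. (\<And>i. norm (w $ i) \<le> (if i \<in> set js then t else 1) * norm (z $ i)) \<Longrightarrow> norm (F w) \<le> M"
  shows "norm (hom_parts js \<alpha> F z) * t ^ (\<Sum>i\<in>set js. \<alpha> $ i) \<le> M"
  using js M
proof (induction js arbitrary: z)
  case Nil
  then show ?case by simp
next
  case (Cons j js)
  define n where "n = (\<Sum>i\<in>set js. \<alpha> $ i)"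
  have "norm (hom_part j (\<alpha> $ j) (hom_parts js \<alpha> F) z) * t ^ (\<alpha> $ j) \<le> M / t ^ n"
  proof (rule hom_part_bound[OF entire_hom_parts[OF F] t])
    fix l :: complex assume l: "norm l = t"
    have "norm (hom_parts js \<alpha> F (scale_coord j l z)) * t ^ n \<le> M"
      unfolding n_def
    proof (rule Cons.IH)
      show "distinct js" using Cons.prems by simp
      fix w :: "complex ^ 'd" assume w: "\<And>i. norm (w $ i) \<le> (if i \<in> set js then t else 1) * norm (scale_coord j l z $ i)"
      show "norm (F w) \<le> M"
      proof (rule Cons.prems(2))
        fix i
        show "norm (w $ i) \<le> (if i \<in> set (j # js) then t else 1) * norm (z $ i)"
          using w[of i] Cons.prems(1) l by (auto simp: scale_coord_nth norm_mult split: if_splits)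
      qed
    qed
    then show "norm (hom_parts js \<alpha> F (scale_coord j l z)) \<le> M / t ^ n"
      using t by (simp add: pos_le_divide_eq)
  qed
  then have "norm (hom_part j (\<alpha> $ j) (hom_parts js \<alpha> F) z) * t ^ (\<alpha> $ j) * t ^ n \<le> M"
    using t by (simp add: pos_le_divide_eq)
  moreover have "(\<Sum>i\<in>set (j # js). \<alpha> $ i) = \<alpha> $ j + n"
    using Cons.prems(1) by (simp add: n_def)
  ultimately show ?case by (simp add: power_add mult.assoc)
qed

text \<open>
  The bound with \<open>t = 2\<close> gives geometric decay in every coordinate.
\<close>

lemma hom_parts_summable:
  fixes F :: "complex ^ 'd \<Rightarrow> complex"
  assumes F: "F \<in> entire" and js: "distinct js"
  shows "(\<lambda>\<alpha>. hom_parts js \<alpha> F z) summable_on {\<alpha>. \<forall>i. i \<notin> set js \<longrightarrow> \<alpha> $ i = 0}"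
proof -
  let ?S = "{\<alpha> :: nat ^ 'd. \<forall>i. i \<notin> set js \<longrightarrow> \<alpha> $ i = 0}"
  obtain M where M: "\<And>w. norm w \<le> 2 * norm z \<Longrightarrow> norm (F w) \<le> M"
    using entire_bounded_on_cball[of F "2 * norm z", OF F] by metis
  have bound: "norm (hom_parts js \<alpha> F z) \<le> M * (\<Prod>i\<in>UNIV. (1 / 2) ^ (\<alpha> $ i))" if "\<alpha> \<in> ?S" for \<alpha>
  proof -
    have "norm (hom_parts js \<alpha> F z) * 2 ^ (\<Sum>i\<in>set js. \<alpha> $ i) \<le> M"
    proof (rule hom_parts_bound[OF F _ js])
      fix w :: "complex ^ 'd" assume w: "\<And>i. norm (w $ i) \<le> (if i \<in> set js then 2 else 1) * norm (z $ i)"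
      have "norm w \<le> norm (2 *\<^sub>R z)"
        by (rule norm_le_componentwise_cart, rule order_trans[OF w]) simp
      then show "norm (F w) \<le> M" by (intro M) simp
    qed simp
    moreover have "(\<Sum>i\<in>set js. \<alpha> $ i) = (\<Sum>i\<in>UNIV. \<alpha> $ i)"
      using that by (intro sum.mono_neutral_left) auto
    moreover have "(\<Prod>i\<in>UNIV. (1 / 2) ^ (\<alpha> $ i)) = (1 / 2 :: real) ^ (\<Sum>i\<in>UNIV. \<alpha> $ i)"
      by (rule power_sum[symmetric])
    ultimately show ?thesis by (simp add: power_one_over pos_le_divide_eq)
  qed
  have "(\<lambda>\<alpha>. M * (\<Prod>i\<in>UNIV. (1 / 2) ^ (\<alpha> $ i))) summable_on ?S"
    by (rule summable_on_subset_banach[OF summable_on_cmult_right[OF summable_multi_index_prod]])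
      (simp_all add: summable_geometric)
  then show ?thesis by (rule abs_summable_summable[OF Infinite_Sum.abs_summable_on_comparison_test'])
    (rule bound)
qed

text \<open>
  Each step replaces every summand by the sum of its homogeneous parts in one more coordinate. The
  resulting double sum can be rearranged because it is absolutely summable. The exponents of coordinates
  outside \<open>js\<close> are pinned to \<open>0\<close> so that each combination of the exponents in \<open>js\<close> is counted once.
\<close>

lemma hom_parts_has_sum:
  fixes F :: "complex ^ 'd \<Rightarrow> complex"
  assumes F: "F \<in> entire" and js: "distinct js"
  shows "((\<lambda>\<alpha>. hom_parts js \<alpha> F z) has_sum F z) {\<alpha>. \<forall>i. i \<notin> set js \<longrightarrow> \<alpha> $ i = 0}"
  using js
proof (induction js)
  case Nil
  have "{\<alpha> :: nat ^ 'd. \<forall>i. i \<notin> set [] \<longrightarrow> \<alpha> $ i = 0} = {0}" by (auto simp: vec_eq_iff)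
  then show ?case using has_sum_finite[of "{0 :: nat ^ 'd}" "\<lambda>\<alpha>. hom_parts [] \<alpha> F z"] by simp
next
  case (Cons j js)
  let ?S = "\<lambda>js. {\<alpha> :: nat ^ 'd. \<forall>i. i \<notin> set js \<longrightarrow> \<alpha> $ i = 0}"
  define upd :: "nat ^ 'd \<Rightarrow> nat \<Rightarrow> nat ^ 'd" where "upd \<alpha> k = (\<chi> i. if i = j then k else \<alpha> $ i)" for \<alpha> k
  have upd: "hom_parts (j # js) (upd \<alpha> k) F = hom_part j k (hom_parts js \<alpha> F)" for \<alpha> k
  proof -
    have "hom_parts js (upd \<alpha> k) F = hom_parts js \<alpha> F"
      using Cons.prems by (intro hom_parts_cong) (auto simp: upd_def)
    then show ?thesis by (simp add: upd_def)
  qed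
  have reindex: "((\<lambda>\<alpha>. hom_parts (j # js) \<alpha> F z) has_sum s) (?S (j # js)) \<longleftrightarrow>
    ((\<lambda>(\<alpha>, k). hom_part j k (hom_parts js \<alpha> F) z) has_sum s) (Sigma (?S js) (\<lambda>_. UNIV))" for s
  proof (rule has_sum_reindex_bij_witness[where i = "\<lambda>(\<alpha>, k). upd \<alpha> k" and j = "\<lambda>\<alpha>. (upd \<alpha> 0, \<alpha> $ j)"])
    fix \<alpha>
    have "upd (upd \<alpha> 0) (\<alpha> $ j) = \<alpha>" by (simp add: upd_def vec_eq_iff)
    then show "(case (upd \<alpha> 0, \<alpha> $ j) of (\<alpha>, k) \<Rightarrow> upd \<alpha> k) = \<alpha>"
      and "(case (upd \<alpha> 0, \<alpha> $ j) of (\<alpha>, k) \<Rightarrow> hom_part j k (hom_parts js \<alpha> F) z)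
        = hom_parts (j # js) \<alpha> F z"
      using upd[of "upd \<alpha> 0" "\<alpha> $ j"] by simp_all
  qed (use Cons.prems in \<open>auto simp: upd_def vec_eq_iff\<close>)
  have "((\<lambda>(\<alpha>, k). hom_part j k (hom_parts js \<alpha> F) z) has_sum F z) (Sigma (?S js) (\<lambda>_. UNIV))"
  proof (rule has_sum_SigmaI)
    show "((\<lambda>k. case (\<alpha>, k) of (\<alpha>, k) \<Rightarrow> hom_part j k (hom_parts js \<alpha> F) z) has_sum
      hom_parts js \<alpha> F z) UNIV" for \<alpha>
      using hom_part_has_sum[OF entire_hom_parts[OF F]] by simp
    show "((\<lambda>\<alpha>. hom_parts js \<alpha> F z) has_sum F z) (?S js)" using Cons by simp
    show "(\<lambda>(\<alpha>, k). hom_part j k (hom_parts js \<alpha> F) z) summable_on Sigma (?S js) (\<lambda>_. UNIV)"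
      using hom_parts_summable[OF F Cons.prems] reindex unfolding summable_on_def by blast
  qed
  then show ?case using reindex by blast
qed


lemma e_basis_scale_coord: "e_basis \<alpha> (scale_coord j l z) = l ^ (\<alpha> $ j) * e_basis \<alpha> z"
proof -
  have "mi_power (scale_coord j l z) \<alpha> =
      (\<Prod>i\<in>UNIV. (if i = j then l ^ (\<alpha> $ j) else 1) * (z $ i) ^ (\<alpha> $ i))"
    unfolding mi_power_def by (rule prod.cong) (auto simp: scale_coord_nth power_mult_distrib)
  also have "\<dots> = l ^ (\<alpha> $ j) * mi_power z \<alpha>"
    by (simp add: prod.distrib mi_power_def)
  finally show ?thesis by (simp add: e_basis_def)
qed

text \<open>
  The index set is a parameter because the homogeneous parts of a series are its partial series.
\<close>

definition basis_series :: "(nat ^ 'd \<Rightarrow> complex) \<Rightarrow> (nat ^ 'd) set \<Rightarrow> complex ^ 'd \<Rightarrow> complex" where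
  "basis_series c B z = (\<Sum>\<^sub>\<infinity>\<alpha>\<in>B. c \<alpha> * e_basis \<alpha> z)"

definition everywhere_summable :: "(nat ^ 'd \<Rightarrow> complex) \<Rightarrow> bool" where
  "everywhere_summable c \<longleftrightarrow> (\<forall>z. (\<lambda>\<alpha>. norm (c \<alpha> * e_basis \<alpha> z)) summable_on UNIV)"

lemma basis_series_has_sum:
  assumes "everywhere_summable c"
  shows "((\<lambda>\<alpha>. c \<alpha> * e_basis \<alpha> z) has_sum basis_series c B z) B"
proof -
  have "(\<lambda>\<alpha>. norm (c \<alpha> * e_basis \<alpha> z)) summable_on UNIV"
    using assms by (simp add: everywhere_summable_def)
  then have "(\<lambda>\<alpha>. c \<alpha> * e_basis \<alpha> z) summable_on UNIV" by (rule abs_summable_summable)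
  then have "(\<lambda>\<alpha>. c \<alpha> * e_basis \<alpha> z) summable_on B" by (rule summable_on_subset_banach) simp
  then show ?thesis unfolding basis_series_def by (rule has_sum_infsum)
qed

text \<open>
  Grouping the terms by their exponent in the \<open>j\<close>-th coordinate exhibits the series, with that
  coordinate scaled by \<open>l\<close>, as a power series in \<open>l\<close>; its coefficients are unique.
\<close>

lemma hom_part_basis_series:
  assumes c: "everywhere_summable c"
  shows "hom_part j k (basis_series c B) = basis_series c {\<beta> \<in> B. \<beta> $ j = k}"
proof
  fix z
  have "taylor_coeff k (\<lambda>l. basis_series c B (scale_coord j l z)) = basis_series c {\<beta> \<in> B. \<beta> $ j = k} z"
  proof (rule taylor_coeff_unique[where d = "\<lambda>k. basis_series c {\<beta> \<in> B. \<beta> $ j = k} z"])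
    fix l
    have "((\<lambda>\<beta>. c \<beta> * e_basis \<beta> (scale_coord j l z)) has_sum basis_series c B (scale_coord j l z)) B"
      by (rule basis_series_has_sum[OF c])
    also have "?this \<longleftrightarrow> ((\<lambda>(k, \<beta>). c \<beta> * e_basis \<beta> z * l ^ k) has_sum basis_series c B (scale_coord j l z))
        (Sigma UNIV (\<lambda>k. {\<beta> \<in> B. \<beta> $ j = k}))"
      by (rule has_sum_reindex_bij_witness[where i = snd and j = "\<lambda>\<beta>. (\<beta> $ j, \<beta>)"])
        (auto simp: e_basis_scale_coord)
    finally have "((\<lambda>k. basis_series c {\<beta> \<in> B. \<beta> $ j = k} z * l ^ k) has_sum
        basis_series c B (scale_coord j l z)) UNIV"
    proof (rule has_sum_SigmaD)
      show "((\<lambda>\<beta>. case (k, \<beta>) of (k, \<beta>) \<Rightarrow> c \<beta> * e_basis \<beta> z * l ^ k) has_sum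
        basis_series c {\<beta> \<in> B. \<beta> $ j = k} z * l ^ k) {\<beta> \<in> B. \<beta> $ j = k}" for k
        using has_sum_cmult_left[OF basis_series_has_sum[OF c]] by simp
    qed
    then show "(\<lambda>k. basis_series c {\<beta> \<in> B. \<beta> $ j = k} z * l ^ k) sums
        basis_series c B (scale_coord j l z)"
      by (rule has_sum_imp_sums)
  qed
  then show "hom_part j k (basis_series c B) z = basis_series c {\<beta> \<in> B. \<beta> $ j = k} z"
    by (simp add: hom_part_def)
qed

lemma hom_parts_basis_series:
  assumes "everywhere_summable c"
  shows "hom_parts js \<alpha> (basis_series c UNIV) = basis_series c {\<beta>. \<forall>i\<in>set js. \<beta> $ i = \<alpha> $ i}"
proof (induction js)
  case (Cons j js)
  have "{\<beta> \<in> {\<beta>. \<forall>i\<in>set js. \<beta> $ i = \<alpha> $ i}. \<beta> $ j = \<alpha> $ j} = {\<beta>. \<forall>i\<in>set (j # js). \<beta> $ i = \<alpha> $ i}"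
    by auto
  then show ?case using Cons hom_part_basis_series[OF assms] by simp
qed simp

lemma hom_parts_scale_coord:
  fixes F :: "complex ^ 'd \<Rightarrow> complex"
  assumes F: "F \<in> entire"
  shows "distinct js \<Longrightarrow> i \<in> set js \<Longrightarrow>
    hom_parts js \<alpha> F (scale_coord i c z) = c ^ (\<alpha> $ i) * hom_parts js \<alpha> F z"
proof (induction js arbitrary: z)
  case (Cons j js)
  show ?case
  proof (cases "i = j")
    case True
    then show ?thesis using hom_part_scale_coord[OF entire_hom_parts[OF F]] by simp
  next
    case False
    then have "hom_parts js \<alpha> F (scale_coord i c z) = c ^ (\<alpha> $ i) * hom_parts js \<alpha> F z" for z
      using Cons by simp
    from hom_part_scale_other_coord[OF entire_hom_parts[OF F] False this] show ?thesis by simp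
  qed
qed simp

definition coords :: "'d::finite list" where
  "coords = (SOME js. distinct js \<and> set js = UNIV)"

lemma coords: "distinct (coords :: 'd::finite list)" "set (coords :: 'd list) = UNIV"
proof -
  have "\<exists>js :: 'd list. distinct js \<and> set js = UNIV"
    using finite_distinct_list[of "UNIV :: 'd set"] by auto
  then have "distinct (coords :: 'd list) \<and> set (coords :: 'd list) = UNIV"
    unfolding coords_def by (rule someI_ex)
  then show "distinct (coords :: 'd list)" "set (coords :: 'd list) = UNIV" by auto
qed

text \<open>
  A function that is homogeneous in each coordinate is a monomial: the point \<open>(1, \<dots>, 1)\<close> is moved to
  \<open>z\<close> by scaling one coordinate after the other.
\<close>

lemma hom_parts_coords_eq:
  fixes F :: "complex ^ 'd \<Rightarrow> complex"
  assumes F: "F \<in> entire"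
  shows "hom_parts coords \<alpha> F z = mi_power z \<alpha> * hom_parts coords \<alpha> F (\<chi> i. 1)"
proof -
  have "hom_parts coords \<alpha> F (\<chi> i. if i \<in> S then z $ i else 1) =
      (\<Prod>i\<in>S. (z $ i) ^ (\<alpha> $ i)) * hom_parts coords \<alpha> F (\<chi> i. 1)" for S
  proof (induction S rule: finite_induct[OF finite])
    case (2 j S)
    have "(\<chi> i. if i \<in> insert j S then z $ i else 1) =
        scale_coord j (z $ j) (\<chi> i. if i \<in> S then z $ i else 1)"
      using 2 by (auto simp: vec_eq_iff scale_coord_nth)
    then show ?case using 2 hom_parts_scale_coord[OF F coords(1), of j] by (simp add: coords(2))
  qed simp
  from this[of UNIV] show ?thesis by (simp add: mi_power_def)
qed

text \<open>
  The value of the homogeneous part at \<open>(1, \<dots>, 1)\<close> is the coefficient of \<open>z\<^sup>\<alpha>\<close>; the square root converts it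
  into the coefficient of the normalised monomial \<open>e\<^sub>\<alpha>\<close>.
\<close>

definition taylor_map :: "(complex ^ 'd \<Rightarrow> complex) \<Rightarrow> nat ^ 'd \<Rightarrow> complex" where
  "taylor_map F \<alpha> = of_real (sqrt (real (mi_fact \<alpha>))) * hom_parts coords \<alpha> F (\<chi> i. 1)"

lemma mi_fact_pos: "mi_fact \<alpha> > 0"
  by (simp add: mi_fact_def prod_pos)

lemma taylor_map_e_basis:
  assumes "F \<in> entire"
  shows "taylor_map F \<alpha> * e_basis \<alpha> z = hom_parts coords \<alpha> F z"
  using hom_parts_coords_eq[OF assms, of \<alpha> z] mi_fact_pos[of \<alpha>]
  by (simp add: taylor_map_def e_basis_def)

lemma taylor_map_has_sum:
  assumes "F \<in> entire"
  shows "((\<lambda>\<alpha>. taylor_map F \<alpha> * e_basis \<alpha> z) has_sum F z) UNIV"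
  using hom_parts_has_sum[OF assms coords(1), of z]
  by (simp add: taylor_map_e_basis[OF assms] coords(2))

lemma taylor_map_bound:
  fixes F :: "complex ^ 'd \<Rightarrow> complex"
  assumes F: "F \<in> entire" and M: "\<And>w. norm w \<le> norm z \<Longrightarrow> norm (F w) \<le> M"
  shows "norm (taylor_map F \<alpha>) * norm (e_basis \<alpha> z) \<le> M"
proof -
  have "norm (hom_parts coords \<alpha> F z) * 1 ^ (\<Sum>i\<in>set coords. \<alpha> $ i) \<le> M"
  proof (rule hom_parts_bound[OF F zero_less_one coords(1)])
    fix w :: "complex ^ 'd"
    assume "\<And>i. norm (w $ i) \<le> (if i \<in> set coords then 1 else 1) * norm (z $ i)"
    then have "norm w \<le> norm z" by (intro norm_le_componentwise_cart) simp
    then show "norm (F w) \<le> M" by (rule M)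
  qed
  then show ?thesis by (simp add: taylor_map_e_basis[OF F, symmetric] norm_mult)
qed

text \<open>
  Extracting the homogeneous parts in all coordinates leaves the partial series over a single index.
\<close>

lemma taylor_map_basis_series:
  fixes c :: "nat ^ 'd \<Rightarrow> complex"
  assumes "everywhere_summable c"
  shows "taylor_map (basis_series c UNIV) = c"
proof
  fix \<alpha> :: "nat ^ 'd"
  have "{\<beta>. \<forall>i\<in>set coords. \<beta> $ i = \<alpha> $ i} = {\<alpha>}" by (auto simp: coords vec_eq_iff)
  then have "hom_parts coords \<alpha> (basis_series c UNIV) (\<chi> i. 1) = c \<alpha> * e_basis \<alpha> (\<chi> i. 1)"
    using hom_parts_basis_series[OF assms, of coords \<alpha>] by (simp add: basis_series_def)
  then show "taylor_map (basis_series c UNIV) \<alpha> = c \<alpha>"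
    using mi_fact_pos[of \<alpha>] by (simp add: taylor_map_def e_basis_def mi_power_def)
qed

lemma basis_series_taylor_map:
  assumes "F \<in> entire"
  shows "basis_series (taylor_map F) UNIV = F"
  using infsumI[OF taylor_map_has_sum[OF assms]] by (simp add: basis_series_def fun_eq_iff)

lemma norm_e_basis_le:
  fixes z w :: "complex ^ 'd"
  assumes "\<And>i. norm (z $ i) \<le> norm (w $ i)"
  shows "norm (e_basis \<alpha> z) \<le> norm (e_basis \<alpha> w)"
proof -
  have "norm (mi_power z \<alpha>) \<le> norm (mi_power w \<alpha>)"
    unfolding mi_power_def prod_norm[symmetric] norm_power
    by (intro prod_mono conjI power_mono assms) auto
  then show ?thesis unfolding e_basis_def norm_divide by (rule divide_right_mono) simp
qed

text \<open>
  On a ball of radius \<open>R\<close> the terms are dominated by their values at \<open>(R, \<dots>, R)\<close>, so the Weierstrass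
  M-test gives locally uniform convergence of the sums over \<open>|\<alpha>| \<le> n\<close>.
\<close>

lemma entire_basis_series:
  fixes c :: "nat ^ 'd \<Rightarrow> complex"
  assumes c: "everywhere_summable c"
  shows "basis_series c UNIV \<in> entire"
proof (rule entire_uniform_limit)
  define f where "f n z = (\<Sum>\<alpha> | mi_length \<alpha> \<le> n. c \<alpha> * e_basis \<alpha> z)" for n z
  show "f n \<in> entire" for n
    unfolding f_def by (intro entire_sum entire_cmult entire_e_basis)
  fix R :: real
  define w :: "complex ^ 'd" where "w = (\<chi> i. of_real R)"
  have "uniform_limit (cball 0 R) (\<lambda>X z. \<Sum>\<alpha>\<in>X. c \<alpha> * e_basis \<alpha> z) (basis_series c UNIV)
      (finite_subsets_at_top UNIV)"
  proof (rule Weierstrass_m_test_general')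
    show "(\<lambda>\<alpha>. norm (c \<alpha> * e_basis \<alpha> w)) summable_on UNIV"
      using c by (simp add: everywhere_summable_def)
    fix \<alpha> and z :: "complex ^ 'd" assume "z \<in> cball 0 R"
    then have "norm (z $ i) \<le> norm (w $ i)" for i
      using Finite_Cartesian_Product.norm_nth_le[of z i] by (simp add: w_def)
    then show "norm (c \<alpha> * e_basis \<alpha> z) \<le> norm (c \<alpha> * e_basis \<alpha> w)"
      by (simp add: norm_mult mult_left_mono norm_e_basis_le)
  qed (rule basis_series_has_sum[OF c])
  moreover have "filterlim (\<lambda>n. {\<alpha> :: nat ^ 'd. mi_length \<alpha> \<le> n}) (finite_subsets_at_top UNIV) sequentially"
    unfolding filterlim_finite_subsets_at_top
  proof (intro allI impI)
    fix X :: "(nat ^ 'd) set" assume X: "finite X \<and> X \<subseteq> UNIV"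
    have "X \<subseteq> {\<alpha>. mi_length \<alpha> \<le> n}" if "Max (mi_length ` X) \<le> n" for n
    proof
      fix \<alpha> assume "\<alpha> \<in> X"
      then have "mi_length \<alpha> \<le> Max (mi_length ` X)" using X by (intro Max_ge) auto
      then show "\<alpha> \<in> {\<alpha>. mi_length \<alpha> \<le> n}" using that by simp
    qed
    then show "\<forall>\<^sub>F n in sequentially. finite {\<alpha> :: nat ^ 'd. mi_length \<alpha> \<le> n} \<and>
        X \<subseteq> {\<alpha>. mi_length \<alpha> \<le> n} \<and> {\<alpha> :: nat ^ 'd. mi_length \<alpha> \<le> n} \<subseteq> UNIV"
      unfolding eventually_sequentially using finite_mi_length_le by blast
  qed
  ultimately have "uniform_limit (cball 0 R) (\<lambda>n z. \<Sum>\<alpha> | mi_length \<alpha> \<le> n. c \<alpha> * e_basis \<alpha> z)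
      (basis_series c UNIV) sequentially"
    by (rule filterlim_compose)
  then show "uniform_limit (cball 0 R) f (basis_series c UNIV) sequentially"
    by (simp only: f_def[abs_def])
qed


section \<open>Growth estimates\<close>

lemma power_le_exp_powr:
  assumes "a > 0" "\<epsilon> > 0"
  obtains C where "C > 0" "\<And>n :: nat. (1 + real n) ^ m \<le> C * exp (\<epsilon> * real n powr a)"
proof -
  have "(\<lambda>n. (1 + real n) ^ m * exp (- (\<epsilon> * real n powr a))) \<longlonglongrightarrow> 0"
    using assms by real_asymp
  then have "Bseq (\<lambda>n. (1 + real n) ^ m * exp (- (\<epsilon> * real n powr a)))"
    by (intro convergent_imp_Bseq convergentI)
  then obtain C where C: "C > 0" "\<And>n. norm ((1 + real n) ^ m * exp (- (\<epsilon> * real n powr a))) \<le> C"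
    by (rule BseqE) blast
  have "(1 + real n) ^ m \<le> C * exp (\<epsilon> * real n powr a)" for n
    using C(2)[of n] by (simp add: exp_minus field_simps)
  with C(1) show ?thesis by (rule that)
qed

lemma coordinate_le_mi_length: "\<alpha> $ i \<le> mi_length \<alpha>"
  unfolding mi_length_def by (rule member_le_sum) simp_all

lemma prod_one_plus_le: "(\<Prod>i\<in>UNIV. 1 + real (\<alpha> $ i)) \<le> (1 + real (mi_length \<alpha>)) ^ CARD('d)"
  for \<alpha> :: "nat ^ 'd"
proof -
  have "(\<Prod>i\<in>UNIV. 1 + real (\<alpha> $ i)) \<le> (\<Prod>i\<in>(UNIV :: 'd set). 1 + real (mi_length \<alpha>))"
    by (intro prod_mono) (simp add: coordinate_le_mi_length)
  then show ?thesis by simp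
qed

text \<open>
  The exponential beats every power of \<open>1 + |\<alpha>|\<close>, in particular one that dominates
  \<open>\<Prod>\<^sub>i (1 + \<alpha>\<^sub>i)\<^sup>2\<close>, whose inverse is summable.
\<close>

lemma summable_exp_minus_powr:
  assumes "a > 0" "\<epsilon> > 0"
  shows "(\<lambda>\<alpha> :: nat ^ 'd. exp (- (\<epsilon> * real (mi_length \<alpha>) powr a))) summable_on UNIV"
proof -
  obtain C where C: "C > 0"
    "\<And>n. (1 + real n) ^ (CARD('d) * 2) \<le> C * exp (\<epsilon> * real n powr a)"
    using power_le_exp_powr[OF assms, of "CARD('d) * 2"] by metis
  have "summable (\<lambda>k. inverse (real (Suc k) ^ 2))"
    by (subst summable_Suc_iff) (rule inverse_power_summable, simp)
  then have "(\<lambda>\<alpha> :: nat ^ 'd. \<Prod>i\<in>UNIV. inverse ((1 + real (\<alpha> $ i)) ^ 2)) summable_on UNIV"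
    using summable_multi_index_prod[of "\<lambda>(i :: 'd) k. inverse ((1 + real k) ^ 2)"] by simp
  then have *: "(\<lambda>\<alpha> :: nat ^ 'd. C * (\<Prod>i\<in>UNIV. inverse ((1 + real (\<alpha> $ i)) ^ 2))) summable_on UNIV"
    by (rule summable_on_cmult_right)
  show ?thesis
  proof (rule summable_on_comparison_test[OF *])
    fix \<alpha> :: "nat ^ 'd"
    define Q where "Q = (\<Prod>i\<in>UNIV. 1 + real (\<alpha> $ i))"
    have Q: "Q > 0" unfolding Q_def by (intro prod_pos) (simp add: add_pos_nonneg)
    have "Q ^ 2 \<le> ((1 + real (mi_length \<alpha>)) ^ CARD('d)) ^ 2"
      unfolding Q_def by (intro power_mono prod_one_plus_le prod_nonneg) simp
    also have "\<dots> \<le> C * exp (\<epsilon> * real (mi_length \<alpha>) powr a)"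
      using C(2) by (simp add: power_mult[symmetric])
    finally have "exp (- (\<epsilon> * real (mi_length \<alpha>) powr a)) \<le> C * inverse (Q ^ 2)"
      using Q by (simp add: exp_minus field_simps)
    moreover have "(\<Prod>i\<in>UNIV. inverse ((1 + real (\<alpha> $ i)) ^ 2)) = inverse (Q ^ 2)"
      unfolding Q_def prod_power_distrib using prod_inversef[of "\<lambda>i. (1 + real (\<alpha> $ i)) ^ 2" UNIV]
      by (simp add: o_def)
    ultimately show "exp (- (\<epsilon> * real (mi_length \<alpha>) powr a)) \<le>
        C * (\<Prod>i\<in>UNIV. inverse ((1 + real (\<alpha> $ i)) ^ 2))" by simp
  qed simp
qed

text \<open>
  The first summand dominates for \<open>n \<le> y\<close>, the second for \<open>n \<ge> y\<close>. The bound is affine in \<open>n\<close>, which turns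
  the exponential weight into a geometric one.
\<close>

lemma powr_le_affine:
  fixes y :: real
  assumes a: "0 < a" "a \<le> 1" and y: "y > 0"
  shows "real n powr a \<le> y powr a + y powr (a - 1) * real n"
proof (cases "real n \<le> y")
  case True
  then have "real n powr a \<le> y powr a" using a by (intro powr_mono2) auto
  then show ?thesis by (simp add: add_increasing2)
next
  case False
  then have n: "real n > 0" using y by linarith
  have "real n powr (a - 1) \<le> y powr (a - 1)" using False a y by (intro powr_mono2') auto
  then have "real n powr (a - 1) * real n \<le> y powr (a - 1) * real n" by (rule mult_right_mono) simp
  moreover have "real n powr (a - 1) * real n = real n powr a" using n by (simp add: powr_diff)
  ultimately show ?thesis using y by (simp add: add_increasing)
qed

lemma norm_e_basis_sq: "(norm (e_basis \<alpha> z))\<^sup>2 = (\<Prod>i\<in>UNIV. ((norm (z $ i))\<^sup>2) ^ (\<alpha> $ i) / fact (\<alpha> $ i))"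
proof -
  have "(norm (e_basis \<alpha> z))\<^sup>2 = (norm (mi_power z \<alpha>))\<^sup>2 / real (mi_fact \<alpha>)"
    by (simp add: e_basis_def norm_divide power_divide)
  also have "(norm (mi_power z \<alpha>))\<^sup>2 = (\<Prod>i\<in>UNIV. ((norm (z $ i))\<^sup>2) ^ (\<alpha> $ i))"
    by (simp add: mi_power_def prod_norm[symmetric] norm_power prod_power_distrib
        power_mult[symmetric] mult.commute)
  also have "real (mi_fact \<alpha>) = (\<Prod>i\<in>UNIV. fact (\<alpha> $ i))"
    by (simp add: mi_fact_def)
  finally show ?thesis by (simp add: prod_dividef)
qed

lemma norm_sq_eq_sum: "(norm z)\<^sup>2 = (\<Sum>i\<in>UNIV. (norm (z $ i))\<^sup>2)" for z :: "complex ^ 'd"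
  by (simp add: norm_vec_def L2_set_def sum_nonneg)

text \<open>
  Replacing \<open>|\<alpha>|\<^sup>a\<close> by its affine bound at \<open>y\<close> multiplies each \<open>|z\<^sub>i|\<^sup>2\<close> by \<open>exp u\<close> with
  \<open>u = R * y\<^sup>a\<^sup>-\<^sup>1\<close>, after which the sum is a product of exponential series with value
  \<open>exp (exp u * |z|\<^sup>2)\<close>. As \<open>exp u \<le> 1 + u * exp R\<close>, the excess over \<open>exp y\<close> is of order
  \<open>exp (const * y\<^sup>a)\<close>. Taking \<open>y \<ge> 1\<close> keeps \<open>u \<le> R\<close>, also near \<open>z = 0\<close>.
\<close>

lemma sum_exp_powr_e_basis_sq_le:
  fixes z :: "complex ^ 'd" and R y :: real
  assumes a: "0 < a" "a \<le> 1" and R: "R \<ge> 0" and y: "y \<ge> 1" "(norm z)\<^sup>2 \<le> y" and A: "finite A"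
  shows "(\<Sum>\<alpha>\<in>A. exp (R * real (mi_length \<alpha>) powr a) * (norm (e_basis \<alpha> z))\<^sup>2)
    \<le> exp (y + R * (1 + exp R) * y powr a)"
proof -
  define u where "u = R * y powr (a - 1)"
  have u: "0 \<le> u" "u \<le> R"
    using R y a powr_mono2'[of "a - 1" 1 y] by (auto simp: u_def mult_left_le)
  have yu: "y * u = R * y powr a" using y by (simp add: u_def powr_diff)
  have summand: "exp (R * real (mi_length \<alpha>) powr a) * (norm (e_basis \<alpha> z))\<^sup>2 \<le>
    exp (R * y powr a) * (\<Prod>i\<in>UNIV. (exp u * (norm (z $ i))\<^sup>2) ^ (\<alpha> $ i) / fact (\<alpha> $ i))" for \<alpha>
  proof -
    have "R * real (mi_length \<alpha>) powr a \<le> R * (y powr a + y powr (a - 1) * real (mi_length \<alpha>))"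
      using y R by (intro mult_left_mono powr_le_affine a) auto
    also have "\<dots> = R * y powr a + real (mi_length \<alpha>) * u" by (simp add: u_def algebra_simps)
    finally have "exp (R * real (mi_length \<alpha>) powr a) \<le> exp (R * y powr a + real (mi_length \<alpha>) * u)"
      by simp
    also have "\<dots> = exp (R * y powr a) * exp u ^ mi_length \<alpha>"
      by (simp only: exp_add exp_of_nat_mult)
    finally have "exp (R * real (mi_length \<alpha>) powr a) \<le> exp (R * y powr a) * exp u ^ mi_length \<alpha>" .
    then have "exp (R * real (mi_length \<alpha>) powr a) * (norm (e_basis \<alpha> z))\<^sup>2 \<le>
        exp (R * y powr a) * exp u ^ mi_length \<alpha> * (norm (e_basis \<alpha> z))\<^sup>2"
      by (rule mult_right_mono) simp
    also have "\<dots> = exp (R * y powr a) *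
        (\<Prod>i\<in>UNIV. (exp u * (norm (z $ i))\<^sup>2) ^ (\<alpha> $ i) / fact (\<alpha> $ i))"
      unfolding norm_e_basis_sq mi_length_def power_sum mult.assoc prod.distrib[symmetric]
      by (simp add: power_mult_distrib)
    finally show ?thesis .
  qed
  have "(\<Sum>\<alpha>\<in>A. exp (R * real (mi_length \<alpha>) powr a) * (norm (e_basis \<alpha> z))\<^sup>2) \<le>
      exp (R * y powr a) * (\<Sum>\<alpha>\<in>A. \<Prod>i\<in>UNIV. (exp u * (norm (z $ i))\<^sup>2) ^ (\<alpha> $ i) / fact (\<alpha> $ i))"
    unfolding sum_distrib_left by (intro sum_mono summand)
  also have "(\<Sum>\<alpha>\<in>A. \<Prod>i\<in>UNIV. (exp u * (norm (z $ i))\<^sup>2) ^ (\<alpha> $ i) / fact (\<alpha> $ i)) \<le>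
      (\<Prod>i\<in>UNIV. \<Sum>k. (exp u * (norm (z $ i))\<^sup>2) ^ k / fact k)"
    by (rule sum_multi_index_prod_le)
      (use A summable_exp in \<open>auto simp: divide_inverse mult.commute\<close>)
  also have "(\<Prod>i\<in>UNIV. \<Sum>k. (exp u * (norm (z $ i))\<^sup>2) ^ k / fact k) =
      (\<Prod>i\<in>UNIV. exp (exp u * (norm (z $ i))\<^sup>2))"
    by (simp add: exp_def divide_inverse mult.commute)
  also have "\<dots> = exp (exp u * (norm z)\<^sup>2)"
    by (simp add: norm_sq_eq_sum exp_sum sum_distrib_left)
  also have "exp (R * y powr a) * exp (exp u * (norm z)\<^sup>2) \<le> exp (y + R * (1 + exp R) * y powr a)"
  proof -
    have "exp u * (norm z)\<^sup>2 \<le> exp u * y" using y by simp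
    also have "exp u \<le> 1 + u * exp R"
    proof -
      have "(1 - u) * exp u \<le> exp (- u) * exp u"
        using exp_ge_add_one_self[of "- u"] by (intro mult_right_mono) auto
      then have "exp u \<le> 1 + u * exp u" by (simp add: exp_minus algebra_simps)
      also have "\<dots> \<le> 1 + u * exp R" using u by (simp add: mult_left_mono)
      finally show ?thesis .
    qed
    then have "exp u * y \<le> (1 + u * exp R) * y" using y by (intro mult_right_mono) auto
    also have "\<dots> = y + exp R * (y * u)" by (simp add: algebra_simps)
    finally have "R * y powr a + exp u * (norm z)\<^sup>2 \<le> y + R * (1 + exp R) * y powr a"
      unfolding yu by (simp add: algebra_simps)
    then show ?thesis by (simp add: exp_add[symmetric])
  qed
  finally show ?thesis by simp
qed

text \<open>
  The parameter of the function weight that is reached from the sequence weight with parameter \<open>r\<close>. It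
  tends to \<open>0\<close> with \<open>r\<close>, as the projective limits require.
\<close>

definition growth_shift :: "real \<Rightarrow> real" where
  "growth_shift r = 2 * r * (1 + exp (4 * r))"

text \<open>
  Cauchy--Schwarz with the splitting \<open>exp (r w) = exp (- r w) * exp (2 r w)\<close>: the first factor is square
  summable over all multi-indices, and the second leads to the preceding estimate with \<open>R = 4 * r\<close>.
\<close>

lemma sum_vartheta_e_basis_le:
  fixes s r :: real
  assumes s: "s \<ge> 1 / 2" and r: "r > 0"
  obtains C where "C > 0"
    "\<And>A (z :: complex ^ 'd). finite A \<Longrightarrow>
      (\<Sum>\<alpha>\<in>A. vartheta r s \<alpha> * norm (e_basis \<alpha> z)) \<le> C * omega2 (growth_shift r) s z"
proof -
  define a where "a = 1 / (2 * s)"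
  have a: "0 < a" "a \<le> 1" using s by (auto simp: a_def)
  define w where "w \<alpha> = real (mi_length \<alpha>) powr a" for \<alpha> :: "nat ^ 'd"
  (* K is increased by 1 below to make the constant positive without computing K. *)
  define K where "K = (\<Sum>\<^sub>\<infinity>\<alpha> :: nat ^ 'd. exp (- (2 * r * w \<alpha>)))"
  have K: "(\<lambda>\<alpha> :: nat ^ 'd. exp (- (2 * r * w \<alpha>))) summable_on UNIV"
    unfolding w_def using summable_exp_minus_powr[OF a(1), of "2 * r"] r by simp
  have "K \<ge> 0" unfolding K_def by (rule infsum_nonneg) simp
  define C where "C = sqrt (K + 1) * exp (1 / 2 + growth_shift r)"
  show ?thesis
  proof (rule that[of C])
    show "C > 0" using \<open>K \<ge> 0\<close> by (simp add: C_def)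
    fix A and z :: "complex ^ 'd" assume A: "finite (A :: (nat ^ 'd) set)"
    define y where "y = max 1 ((norm z)\<^sup>2)"
    have y: "y \<ge> 1" "(norm z)\<^sup>2 \<le> y" "y \<le> (norm z)\<^sup>2 + 1" by (auto simp: y_def)
    have ya: "y powr a \<le> norm z powr (1 / s) + 1"
    proof -
      have "((norm z)\<^sup>2) powr a = norm z powr (1 / s)"
        using powr_powr[of "norm z" 2 a] s by (simp add: a_def)
      then show ?thesis by (auto simp: y_def max_def)
    qed
    have "(\<Sum>\<alpha>\<in>A. vartheta r s \<alpha> * norm (e_basis \<alpha> z)) =
        (\<Sum>\<alpha>\<in>A. exp (- (r * w \<alpha>)) * (exp (2 * r * w \<alpha>) * norm (e_basis \<alpha> z)))"
      by (rule sum.cong) (simp_all add: vartheta_def w_def a_def mult.assoc[symmetric] exp_add[symmetric])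
    also have "\<dots> \<le> L2_set (\<lambda>\<alpha>. exp (- (r * w \<alpha>))) A * L2_set (\<lambda>\<alpha>. exp (2 * r * w \<alpha>) * norm (e_basis \<alpha> z)) A"
      using L2_set_mult_ineq[of "\<lambda>\<alpha>. exp (- (r * w \<alpha>))" "\<lambda>\<alpha>. exp (2 * r * w \<alpha>) * norm (e_basis \<alpha> z)" A]
      by simp
    also have "\<dots> \<le> sqrt (K + 1) * exp ((y + 4 * r * (1 + exp (4 * r)) * y powr a) / 2)"
    proof (rule mult_mono)
      have "(\<Sum>\<alpha>\<in>A. (exp (- (r * w \<alpha>)))\<^sup>2) = (\<Sum>\<alpha>\<in>A. exp (- (2 * r * w \<alpha>)))"
        by (simp add: power2_eq_square exp_add[symmetric] mult.assoc)
      also have "\<dots> \<le> K" unfolding K_def by (rule finite_sum_le_infsum[OF K A]) auto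
      finally show "L2_set (\<lambda>\<alpha>. exp (- (r * w \<alpha>))) A \<le> sqrt (K + 1)"
        unfolding L2_set_def by (intro real_sqrt_le_mono) simp
      have "(\<Sum>\<alpha>\<in>A. (exp (2 * r * w \<alpha>) * norm (e_basis \<alpha> z))\<^sup>2) =
          (\<Sum>\<alpha>\<in>A. exp (4 * r * w \<alpha>) * (norm (e_basis \<alpha> z))\<^sup>2)"
        by (simp add: power_mult_distrib exp_double[symmetric] mult.assoc)
      also have "\<dots> \<le> exp (y + 4 * r * (1 + exp (4 * r)) * y powr a)"
        unfolding w_def using r by (intro sum_exp_powr_e_basis_sq_le a y A) simp
      also have "\<dots> = (exp ((y + 4 * r * (1 + exp (4 * r)) * y powr a) / 2))\<^sup>2"
        by (simp add: power2_eq_square exp_add[symmetric])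
      finally show "L2_set (\<lambda>\<alpha>. exp (2 * r * w \<alpha>) * norm (e_basis \<alpha> z)) A \<le>
          exp ((y + 4 * r * (1 + exp (4 * r)) * y powr a) / 2)"
        unfolding L2_set_def by (rule real_le_lsqrt[rotated]) simp
    qed (use \<open>K \<ge> 0\<close> in \<open>simp_all add: L2_set_nonneg\<close>)
    also have "\<dots> \<le> sqrt (K + 1) * exp ((norm z)\<^sup>2 / 2 + 1 / 2 + growth_shift r * (norm z powr (1 / s) + 1))"
    proof -
      have "growth_shift r * y powr a \<le> growth_shift r * (norm z powr (1 / s) + 1)"
        using ya r by (intro mult_left_mono) (simp_all add: growth_shift_def add_nonneg_nonneg)
      then have "(y + 4 * r * (1 + exp (4 * r)) * y powr a) / 2 \<le>
          (norm z)\<^sup>2 / 2 + 1 / 2 + growth_shift r * (norm z powr (1 / s) + 1)"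
        using y(3) by (simp add: growth_shift_def field_simps)
      then show ?thesis using \<open>K \<ge> 0\<close> by (intro mult_left_mono) simp_all
    qed
    also have "\<dots> = C * omega2 (growth_shift r) s z"
      by (simp add: C_def omega2_def mult.assoc exp_add[symmetric] algebra_simps)
    finally show "(\<Sum>\<alpha>\<in>A. vartheta r s \<alpha> * norm (e_basis \<alpha> z)) \<le> C * omega2 (growth_shift r) s z" .
  qed
qed

text \<open>
  A weak form of Stirling's formula; the induction step amounts to \<open>e \<le> (1 + 1 / k) ^ (k + 1)\<close>.
\<close>

lemma fact_exp_le: "fact k * exp (real k) \<le> exp 1 * (1 + real k) * real k ^ k"
proof (cases "k = 0")
  case False
  then have "k \<ge> 1" by simp
  then have "fact k * exp (real k) \<le> exp 1 * real k * real k ^ k"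
  proof (induction k rule: dec_induct)
    case base
    then show ?case by simp
  next
    case (step k)
    have "real k / real (Suc k) \<le> exp (- (1 / real (Suc k)))"
      using exp_ge_add_one_self[of "- (1 / real (Suc k))"] by (simp add: field_simps)
    then have "(real k / real (Suc k)) ^ Suc k \<le> exp (- (1 / real (Suc k))) ^ Suc k"
      by (rule power_mono) simp
    also have "\<dots> = exp (- 1)" by (simp add: exp_of_nat_mult[symmetric] del: of_nat_Suc power_Suc)
    finally have "exp 1 * real k ^ Suc k \<le> real (Suc k) ^ Suc k"
      by (simp add: power_divide exp_minus field_simps del: of_nat_Suc power_Suc)
    then have *: "exp 1 * (real k * real k ^ k) \<le> real (Suc k) ^ Suc k" by simp
    have "fact (Suc k) * exp (real (Suc k)) = real (Suc k) * exp 1 * (fact k * exp (real k))"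
      by (simp add: exp_add algebra_simps)
    also have "\<dots> \<le> real (Suc k) * exp 1 * (exp 1 * real k * real k ^ k)"
      by (intro mult_left_mono step) simp
    also have "\<dots> = exp 1 * real (Suc k) * (exp 1 * (real k * real k ^ k))" by simp
    also have "\<dots> \<le> exp 1 * real (Suc k) * real (Suc k) ^ Suc k"
      by (intro mult_left_mono *) simp
    finally show ?case .
  qed
  also have "\<dots> \<le> exp 1 * (1 + real k) * real k ^ k" by (intro mult_right_mono mult_left_mono) auto
  finally show ?thesis .
qed simp

text \<open>
  The coordinates \<open>sqrt (\<alpha>\<^sub>i)\<close> maximise \<open>|e\<^sub>\<alpha>(z)| * exp (- |z|\<^sup>2 / 2)\<close>, and by Stirling's formula the
  maximum decays at most polynomially in \<open>|\<alpha>|\<close>.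
\<close>

lemma norm_e_basis_sqrt_ge:
  fixes \<alpha> :: "nat ^ 'd"
  defines "z \<equiv> (\<chi> i. of_real (sqrt (real (\<alpha> $ i)))) :: complex ^ 'd"
  shows "(norm z)\<^sup>2 = real (mi_length \<alpha>)"
    and "exp (real (mi_length \<alpha>) / 2) \<le> norm (e_basis \<alpha> z) * (exp 1 * (1 + real (mi_length \<alpha>))) ^ CARD('d)"
proof -
  show "(norm z)\<^sup>2 = real (mi_length \<alpha>)" by (simp add: norm_sq_eq_sum z_def mi_length_def)
  define B where "B = (exp 1 * (1 + real (mi_length \<alpha>))) ^ CARD('d)"
  have B: "B \<ge> 1"
    unfolding B_def by (intro one_le_power mult_ge1_I) auto
  have "exp (real (mi_length \<alpha>)) = (\<Prod>i\<in>UNIV. exp (real (\<alpha> $ i)))"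
    by (simp add: mi_length_def exp_sum)
  also have "\<dots> \<le> (\<Prod>i\<in>UNIV. (real (\<alpha> $ i) ^ (\<alpha> $ i) / fact (\<alpha> $ i)) * (exp 1 * (1 + real (\<alpha> $ i))))"
  proof (intro prod_mono conjI)
    fix i
    show "exp (real (\<alpha> $ i)) \<le> (real (\<alpha> $ i) ^ (\<alpha> $ i) / fact (\<alpha> $ i)) * (exp 1 * (1 + real (\<alpha> $ i)))"
      using fact_exp_le[of "\<alpha> $ i"] by (simp add: pos_le_divide_eq mult_ac)
  qed simp
  also have "\<dots> = (norm (e_basis \<alpha> z))\<^sup>2 * (\<Prod>i\<in>UNIV. exp 1 * (1 + real (\<alpha> $ i)))"
    unfolding norm_e_basis_sq prod.distrib by (simp add: z_def)
  also have "\<dots> \<le> (norm (e_basis \<alpha> z))\<^sup>2 * B"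
    using prod_one_plus_le[of \<alpha>]
    by (intro mult_left_mono) (simp_all add: B_def prod.distrib power_mult_distrib mult_left_mono)
  also have "\<dots> \<le> (norm (e_basis \<alpha> z))\<^sup>2 * (B * B)"
    using B by (intro mult_left_mono) auto
  also have "\<dots> = (norm (e_basis \<alpha> z) * B)\<^sup>2" by (simp add: power2_eq_square)
  finally have "(exp (real (mi_length \<alpha>) / 2))\<^sup>2 \<le> (norm (e_basis \<alpha> z) * B)\<^sup>2"
    by (simp add: power2_eq_square exp_add[symmetric])
  then show "exp (real (mi_length \<alpha>) / 2) \<le> norm (e_basis \<alpha> z) * (exp 1 * (1 + real (mi_length \<alpha>))) ^ CARD('d)"
    unfolding B_def[symmetric] by (rule power2_le_imp_le) (use B in simp)
qed

text \<open>
  Cauchy's estimate at the point of the preceding lemma: the factors \<open>exp (|\<alpha>| / 2)\<close> cancel, and the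
  remaining power of \<open>1 + |\<alpha>|\<close> is absorbed by passing from \<open>r\<close> to \<open>2 * r\<close>.
\<close>

lemma taylor_map_vartheta_bound:
  fixes s r :: real
  assumes s: "s > 0" and r: "r > 0"
  obtains C where "C > 0"
    "\<And>F N (\<alpha> :: nat ^ 'd). F \<in> entire \<Longrightarrow> (\<And>z. norm (F z) \<le> N * omega2 r s z) \<Longrightarrow>
      norm (taylor_map F \<alpha>) \<le> C * N * vartheta (2 * r) s \<alpha>"
proof -
  define a where "a = 1 / (2 * s)"
  have a: "a > 0" using s by (simp add: a_def)
  obtain C where C: "C > 0" "\<And>n. (1 + real n) ^ CARD('d) \<le> C * exp (r * real n powr a)"
    using power_le_exp_powr[OF a r, of "CARD('d)"] by metis
  show ?thesis
  proof (rule that[of "exp 1 ^ CARD('d) * C"])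
    show "exp 1 ^ CARD('d) * C > 0" using C by simp
    fix F :: "complex ^ 'd \<Rightarrow> complex" and N and \<alpha> :: "nat ^ 'd"
    assume F: "F \<in> entire" and N: "\<And>z. norm (F z) \<le> N * omega2 r s z"
    define n where "n = real (mi_length \<alpha>)"
    define z :: "complex ^ 'd" where "z = (\<chi> i. of_real (sqrt (real (\<alpha> $ i))))"
    have z: "(norm z)\<^sup>2 = n" and
      ez: "exp (n / 2) \<le> norm (e_basis \<alpha> z) * (exp 1 * (1 + n)) ^ CARD('d)"
      using norm_e_basis_sqrt_ge[of \<alpha>] by (simp_all add: z_def n_def)
    have "N \<ge> 0" using order_trans[OF norm_ge_zero N[of 0]] by (simp add: omega2_def zero_le_mult_iff)
    have zs: "norm z powr (1 / s) = n powr a"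
      using powr_powr[of "norm z" 2 a] s z by (simp add: a_def)
    have "norm (taylor_map F \<alpha>) * norm (e_basis \<alpha> z) \<le> N * exp (n / 2 + r * n powr a)"
    proof (rule taylor_map_bound[OF F])
      fix w :: "complex ^ 'd" assume w: "norm w \<le> norm z"
      have "norm w powr (1 / s) \<le> norm z powr (1 / s)" using w s by (intro powr_mono2) auto
      moreover have "(norm w)\<^sup>2 \<le> (norm z)\<^sup>2" using w by (intro power_mono) auto
      ultimately have "omega2 r s w \<le> exp (n / 2 + r * n powr a)"
        using r unfolding omega2_def zs z by (simp add: add_mono mult_left_mono)
      then show "norm (F w) \<le> N * exp (n / 2 + r * n powr a)"
        using N[of w] \<open>N \<ge> 0\<close> by (meson mult_left_mono order_trans)
    qed
    then have *: "norm (taylor_map F \<alpha>) * norm (e_basis \<alpha> z) \<le> N * exp (r * n powr a) * exp (n / 2)"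
      by (simp add: exp_add mult_ac)
    have "norm (taylor_map F \<alpha>) * exp (n / 2) \<le>
        norm (taylor_map F \<alpha>) * (norm (e_basis \<alpha> z) * (exp 1 * (1 + n)) ^ CARD('d))"
      by (intro mult_left_mono ez) simp
    also have "\<dots> \<le> N * exp (r * n powr a) * exp (n / 2) * (exp 1 * (1 + n)) ^ CARD('d)"
      using mult_right_mono[OF *, of "(exp 1 * (1 + n)) ^ CARD('d)"] by (simp add: n_def mult.assoc)
    finally have "norm (taylor_map F \<alpha>) \<le> N * exp (r * n powr a) * (exp 1 * (1 + n)) ^ CARD('d)"
      by (simp add: mult.assoc mult.left_commute[of _ "exp (n / 2)"] mult.commute[of _ "exp (n / 2)"])
    also have "\<dots> = N * exp (r * n powr a) * exp 1 ^ CARD('d) * (1 + n) ^ CARD('d)"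
      by (simp add: power_mult_distrib mult.assoc)
    also have "\<dots> \<le> N * exp (r * n powr a) * exp 1 ^ CARD('d) * (C * exp (r * n powr a))"
      unfolding n_def using \<open>N \<ge> 0\<close> by (intro mult_left_mono C) auto
    also have "\<dots> = exp 1 ^ CARD('d) * C * N * vartheta (2 * r) s \<alpha>"
    proof -
      have "exp (r * n powr a) * exp (r * n powr a) = vartheta (2 * r) s \<alpha>"
        by (simp add: vartheta_def n_def a_def exp_add[symmetric])
      then show ?thesis by (simp only: mult_ac)
    qed
    finally show "norm (taylor_map F \<alpha>) \<le> exp 1 ^ CARD('d) * C * N * vartheta (2 * r) s \<alpha>" .
  qed
qed


section \<open>Weighted sequence spaces\<close>

lemma lp_set_infinityI:
  assumes "p = \<infinity>" "\<And>\<alpha>. norm (c \<alpha>) \<le> B"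
  shows "c \<in> lp_set p"
  using assms by (auto simp: lp_set_def intro: bdd_aboveI[of _ B])

lemma lp_set_finite_iff:
  "p \<noteq> \<infinity> \<Longrightarrow> c \<in> lp_set p \<longleftrightarrow> (\<lambda>\<alpha>. norm (c \<alpha>) powr enn2real p) summable_on UNIV"
  by (simp add: lp_set_def)

lemma enn2real_pos: "p > 0 \<Longrightarrow> p \<noteq> \<infinity> \<Longrightarrow> enn2real p > 0"
  by (simp add: enn2real_positive_iff less_top)

lemma norm_le_lp_norm:
  assumes p: "p > 0" and c: "c \<in> lp_set p"
  shows "norm (c \<alpha>) \<le> lp_norm p c"
proof (cases "p = \<infinity>")
  case True
  then show ?thesis using c by (auto simp: lp_set_def lp_norm_def intro: cSUP_upper)
next
  case False
  define q where "q = enn2real p"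
  have q: "q > 0" using enn2real_pos[OF p False] by (simp add: q_def)
  have sm: "(\<lambda>\<alpha>. norm (c \<alpha>) powr q) summable_on UNIV"
    using c False by (simp add: lp_set_finite_iff q_def)
  have "norm (c \<alpha>) powr q \<le> (\<Sum>\<^sub>\<infinity>\<alpha>. norm (c \<alpha>) powr q)"
    using finite_sum_le_infsum[OF sm, of "{\<alpha>}"] by simp
  then have "(norm (c \<alpha>) powr q) powr (1 / q) \<le> (\<Sum>\<^sub>\<infinity>\<alpha>. norm (c \<alpha>) powr q) powr (1 / q)"
    using q by (intro powr_mono2) auto
  moreover have "(norm (c \<alpha>) powr q) powr (1 / q) = norm (c \<alpha>)"
    using q by (simp add: powr_powr)
  ultimately show ?thesis using False by (simp add: lp_norm_def q_def)
qed

lemma lp_set_dominated: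
  assumes p: "p > 0" and d: "d \<in> lp_set p" and le: "\<And>\<alpha>. norm (c \<alpha>) \<le> norm (d \<alpha>)"
  shows "c \<in> lp_set p"
proof (cases "p = \<infinity>")
  case True
  then obtain B where "\<And>\<alpha>. norm (d \<alpha>) \<le> B"
    using d unfolding lp_set_def bdd_above_def by auto
  then show ?thesis by (intro lp_set_infinityI[OF True, of _ B]) (metis le order_trans)
next
  case False
  have "(\<lambda>\<alpha>. norm (c \<alpha>) powr enn2real p) summable_on UNIV"
    by (rule summable_on_comparison_test[OF d[unfolded lp_set_finite_iff[OF False]]])
      (simp_all add: powr_mono2 le)
  then show ?thesis using False by (simp add: lp_set_finite_iff)
qed

text \<open>
  For \<open>p < 1\<close> there is no triangle inequality, but \<open>x + y \<le> 2 * max x y\<close> gives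
  \<open>(x + y)\<^sup>p \<le> (2 * x)\<^sup>p + (2 * y)\<^sup>p\<close> for every \<open>p > 0\<close>.
\<close>

lemma lp_set_linear_combination:
  assumes p: "p > 0" and c: "c \<in> lp_set p" and d: "d \<in> lp_set p"
  shows "(\<lambda>\<alpha>. a * c \<alpha> + b * d \<alpha>) \<in> lp_set p"
proof (cases "p = \<infinity>")
  case True
  obtain B D where "\<And>\<alpha>. norm (c \<alpha>) \<le> B" "\<And>\<alpha>. norm (d \<alpha>) \<le> D"
    using c d True unfolding lp_set_def bdd_above_def by auto
  then have "norm (a * c \<alpha> + b * d \<alpha>) \<le> norm a * B + norm b * D" for \<alpha>
    by (intro order_trans[OF norm_triangle_ineq] add_mono) (simp_all add: norm_mult mult_left_mono)
  then show ?thesis by (rule lp_set_infinityI[OF True])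
next
  case False
  define q where "q = enn2real p"
  have q: "q > 0" using enn2real_pos[OF p False] by (simp add: q_def)
  have "(\<lambda>\<alpha>. (2 * norm a) powr q * norm (c \<alpha>) powr q + (2 * norm b) powr q * norm (d \<alpha>) powr q) summable_on UNIV"
    using c d False by (intro summable_on_add summable_on_cmult_right) (simp_all add: lp_set_finite_iff q_def)
  then have "(\<lambda>\<alpha>. norm (a * c \<alpha> + b * d \<alpha>) powr q) summable_on UNIV"
  proof (rule summable_on_comparison_test)
    fix \<alpha>
    define x y where "x = norm a * norm (c \<alpha>)" and "y = norm b * norm (d \<alpha>)"
    have xy: "x \<ge> 0" "y \<ge> 0" by (simp_all add: x_def y_def)
    have "norm (a * c \<alpha> + b * d \<alpha>) \<le> x + y"
      using norm_triangle_ineq[of "a * c \<alpha>" "b * d \<alpha>"] by (simp add: x_def y_def norm_mult)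
    also have "\<dots> \<le> 2 * max x y" by simp
    finally have "norm (a * c \<alpha> + b * d \<alpha>) powr q \<le> (2 * max x y) powr q"
      using q by (intro powr_mono2) auto
    also have "\<dots> \<le> (2 * x) powr q + (2 * y) powr q" by (simp add: max_def)
    also have "\<dots> = (2 * norm a) powr q * norm (c \<alpha>) powr q + (2 * norm b) powr q * norm (d \<alpha>) powr q"
      by (simp add: x_def y_def powr_mult mult.assoc)
    finally show "norm (a * c \<alpha> + b * d \<alpha>) powr q \<le>
      (2 * norm a) powr q * norm (c \<alpha>) powr q + (2 * norm b) powr q * norm (d \<alpha>) powr q" .
  qed simp
  then show ?thesis using False by (simp add: lp_set_finite_iff q_def)
qed

lemma vartheta_pos: "vartheta r s \<alpha> > 0"
  by (simp add: vartheta_def)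

lemma vartheta_mono: "r \<le> r' \<Longrightarrow> vartheta r s \<alpha> \<le> vartheta r' s \<alpha>"
  by (simp add: vartheta_def mult_right_mono)

abbreviation seq_step :: "ennreal \<Rightarrow> real \<Rightarrow> real \<Rightarrow> (nat ^ 'd \<Rightarrow> complex) set" where
  "seq_step p s r \<equiv> weighted_lp p (\<lambda>\<alpha>. 1 / vartheta r s \<alpha>)"

abbreviation seq_norm :: "ennreal \<Rightarrow> real \<Rightarrow> real \<Rightarrow> (nat ^ 'd \<Rightarrow> complex) \<Rightarrow> real" where
  "seq_norm p s r \<equiv> weighted_lp_norm p (\<lambda>\<alpha>. 1 / vartheta r s \<alpha>)"

lemma norm_le_seq_norm:
  assumes "p > 0" "c \<in> seq_step p s r"
  shows "norm (c \<alpha>) \<le> seq_norm p s r c * vartheta r s \<alpha>"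
proof -
  have "norm (c \<alpha> * of_real (1 / vartheta r s \<alpha>)) \<le> seq_norm p s r c"
    using norm_le_lp_norm[OF assms(1)] assms(2)
    unfolding weighted_lp_def weighted_lp_norm_def by simp
  then show ?thesis using vartheta_pos[of r s \<alpha>]
    by (simp add: norm_divide pos_divide_le_eq less_imp_le)
qed

lemma seq_norm_nonneg:
  assumes "p > 0" "c \<in> seq_step p s r"
  shows "seq_norm p s r c \<ge> 0"
  using norm_le_lp_norm[OF assms(1), of "\<lambda>\<alpha>. c \<alpha> * of_real (1 / vartheta r s \<alpha>)"] assms(2) norm_ge_zero order_trans
  unfolding weighted_lp_def weighted_lp_norm_def by blast

lemma linear_scale_seq_step:
  assumes p: "p > 0"
  shows "linear_scale (seq_step p s)"
  unfolding linear_scale_def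
proof (intro conjI allI impI ballI)
  show "(\<lambda>_. 0) \<in> seq_step p s r" for r by (simp add: weighted_lp_def lp_set_def)
  show "(\<lambda>\<alpha>. a * x \<alpha> + b * y \<alpha>) \<in> seq_step p s r"
    if "x \<in> seq_step p s r" "y \<in> seq_step p s r" for r x y a b
    using lp_set_linear_combination[OF p, of "\<lambda>\<alpha>. x \<alpha> * of_real (1 / vartheta r s \<alpha>)"
        "\<lambda>\<alpha>. y \<alpha> * of_real (1 / vartheta r s \<alpha>)" a b] that
    by (simp add: weighted_lp_def algebra_simps add_divide_distrib)
  show "seq_step p s r \<subseteq> seq_step p s r'" if "r \<le> r'" for r r'
  proof
    fix c :: "nat ^ 'b \<Rightarrow> complex" assume "c \<in> seq_step p s r"
    then have "(\<lambda>\<alpha>. c \<alpha> * of_real (1 / vartheta r s \<alpha>)) \<in> lp_set p" by (simp add: weighted_lp_def)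
    then have "(\<lambda>\<alpha>. c \<alpha> * of_real (1 / vartheta r' s \<alpha>)) \<in> lp_set p"
      by (rule lp_set_dominated[OF p])
        (simp add: norm_mult norm_divide vartheta_pos less_imp_le abs_of_pos frac_le
          vartheta_mono[OF that] divide_left_mono)
    then show "c \<in> seq_step p s r'" by (simp add: weighted_lp_def)
  qed
qed

text \<open>
  The quotient of the weights with parameters \<open>r\<close> and \<open>2 * r\<close> is \<open>p\<close>-summable for every \<open>p\<close>; this is why
  the limits do not depend on \<open>p\<close>.
\<close>

lemma seq_step_sup_bound:
  fixes s r :: real
  assumes p: "p > 0" and s: "s > 0" and r: "r > 0"
  obtains K where "K > 0"
    "\<And>(c :: nat ^ 'd \<Rightarrow> complex) M. (\<And>\<alpha>. norm (c \<alpha>) \<le> M * vartheta r s \<alpha>) \<Longrightarrow>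
      c \<in> seq_step p s (2 * r) \<and> seq_norm p s (2 * r) c \<le> K * M"
proof -
  define a where "a = 1 / (2 * s)"
  have a: "a > 0" using s by (simp add: a_def)
  define g where "g \<alpha> = exp (- (r * real (mi_length \<alpha>) powr a))" for \<alpha> :: "nat ^ 'd"
  have g: "norm (c \<alpha> * of_real (1 / vartheta (2 * r) s \<alpha>)) \<le> M * g \<alpha>"
    if "norm (c \<alpha>) \<le> M * vartheta r s \<alpha>" for c :: "nat ^ 'd \<Rightarrow> complex" and M \<alpha>
  proof -
    have "vartheta r s \<alpha> = g \<alpha> * vartheta (2 * r) s \<alpha>"
      by (simp add: vartheta_def g_def a_def exp_add[symmetric])
    then have "norm (c \<alpha>) \<le> M * g \<alpha> * vartheta (2 * r) s \<alpha>" using that by (simp add: mult.assoc)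
    then show ?thesis using vartheta_pos[of "2 * r" s \<alpha>]
      by (simp add: norm_divide pos_divide_le_eq less_imp_le)
  qed
  have nonneg: "M \<ge> 0" if "\<And>\<alpha>. norm (c \<alpha>) \<le> M * vartheta r s \<alpha>" for c :: "nat ^ 'd \<Rightarrow> complex" and M
    using order_trans[OF norm_ge_zero that[of 0]] vartheta_pos[of r s "0 :: nat ^ 'd"]
    by (simp add: zero_le_mult_iff)
  show ?thesis
  proof (cases "p = \<infinity>")
    case True
    show ?thesis
    proof (rule that[of 1])
      fix c :: "nat ^ 'd \<Rightarrow> complex" and M assume c: "\<And>\<alpha>. norm (c \<alpha>) \<le> M * vartheta r s \<alpha>"
      have "M * g \<alpha> \<le> M * 1" for \<alpha>
        using nonneg[OF c] r by (intro mult_left_mono) (simp_all add: g_def)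
      then have *: "norm (c \<alpha> * of_real (1 / vartheta (2 * r) s \<alpha>)) \<le> M" for \<alpha>
        using g[where c = c and M = M and \<alpha> = \<alpha>, OF c] by (metis mult.right_neutral order_trans)
      then have "c \<in> seq_step p s (2 * r)"
        unfolding weighted_lp_def mem_Collect_eq by (rule lp_set_infinityI[OF True])
      moreover have "seq_norm p s (2 * r) c \<le> M"
        using True * unfolding weighted_lp_norm_def lp_norm_def by (auto intro!: cSUP_least)
      ultimately show "c \<in> seq_step p s (2 * r) \<and> seq_norm p s (2 * r) c \<le> 1 * M" by simp
    qed simp
  next
    case False
    define q where "q = enn2real p"
    have q: "q > 0" using enn2real_pos[OF p False] by (simp add: q_def)
    define S where "S = (\<Sum>\<^sub>\<infinity>\<alpha>. g \<alpha> powr q)"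
    have sm: "(\<lambda>\<alpha>. g \<alpha> powr q) summable_on UNIV"
      using summable_exp_minus_powr[OF a, of "q * r"] q r
      by (simp add: g_def powr_def mult.assoc)
    have "S \<ge> 0" unfolding S_def by (rule infsum_nonneg) simp
    show ?thesis
    proof (rule that[of "S powr (1 / q) + 1"])
      show "S powr (1 / q) + 1 > 0" by (simp add: add_nonneg_pos)
      fix c :: "nat ^ 'd \<Rightarrow> complex" and M assume c: "\<And>\<alpha>. norm (c \<alpha>) \<le> M * vartheta r s \<alpha>"
      note M = nonneg[OF c]
      have le: "norm (c \<alpha> * of_real (1 / vartheta (2 * r) s \<alpha>)) powr q \<le> M powr q * g \<alpha> powr q" for \<alpha>
      proof -
        have "norm (c \<alpha> * of_real (1 / vartheta (2 * r) s \<alpha>)) powr q \<le> (M * g \<alpha>) powr q"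
          using q by (intro powr_mono2 g[where c = c and M = M and \<alpha> = \<alpha>, OF c]) auto
        then show ?thesis using M by (simp add: powr_mult g_def)
      qed
      have sm': "(\<lambda>\<alpha>. M powr q * g \<alpha> powr q) summable_on UNIV"
        by (rule summable_on_cmult_right[OF sm])
      have sc: "(\<lambda>\<alpha>. norm (c \<alpha> * of_real (1 / vartheta (2 * r) s \<alpha>)) powr q) summable_on UNIV"
        by (rule summable_on_comparison_test[OF sm' le]) simp
      then have "c \<in> seq_step p s (2 * r)"
        using False unfolding weighted_lp_def q_def by (simp add: lp_set_finite_iff)
      moreover have "seq_norm p s (2 * r) c \<le> S powr (1 / q) * M"
      proof -
        have "(\<Sum>\<^sub>\<infinity>\<alpha>. norm (c \<alpha> * of_real (1 / vartheta (2 * r) s \<alpha>)) powr q) \<le> (\<Sum>\<^sub>\<infinity>\<alpha>. M powr q * g \<alpha> powr q)"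
          by (rule infsum_mono[OF sc sm' le])
        also have "\<dots> = M powr q * S" unfolding S_def by (rule infsum_cmult_right') 
        finally have "(\<Sum>\<^sub>\<infinity>\<alpha>. norm (c \<alpha> * of_real (1 / vartheta (2 * r) s \<alpha>)) powr q) powr (1 / q)
            \<le> (M powr q * S) powr (1 / q)"
          using q by (intro powr_mono2 infsum_nonneg) auto
        also have "\<dots> = S powr (1 / q) * M"
          using q M \<open>S \<ge> 0\<close> by (simp add: powr_mult powr_powr mult.commute)
        finally show ?thesis using False by (simp add: weighted_lp_norm_def lp_norm_def q_def)
      qed
      ultimately show "c \<in> seq_step p s (2 * r) \<and> seq_norm p s (2 * r) c \<le> (S powr (1 / q) + 1) * M"
        using M by (simp add: distrib_right)
    qed
  qed
qed

lemma A_0_subset_seq_step: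
  assumes p: "p > 0" and s: "s > 0" and c: "c \<in> A_0" and r: "r > 0"
  shows "c \<in> seq_step p s r"
proof -
  have fin: "finite {\<alpha>. c \<alpha> \<noteq> 0}" using c by (simp add: A_0_def)
  define M where "M = (\<Sum>\<alpha> | c \<alpha> \<noteq> 0. norm (c \<alpha>))"
  have "norm (c \<alpha>) \<le> M * vartheta (r / 2) s \<alpha>" for \<alpha>
  proof -
    have "norm (c \<alpha>) \<le> M"
      unfolding M_def using fin member_le_sum[of \<alpha> "{\<alpha>. c \<alpha> \<noteq> 0}" "\<lambda>\<alpha>. norm (c \<alpha>)"]
      by (cases "c \<alpha> = 0") (auto simp: sum_nonneg)
    moreover have "M \<ge> 0" by (simp add: M_def sum_nonneg)
    moreover have "vartheta (r / 2) s \<alpha> \<ge> 1" using r by (simp add: vartheta_def)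
    ultimately show ?thesis by (metis mult.right_neutral mult_left_mono order_trans)
  qed
  then show ?thesis
    using seq_step_sup_bound[OF p s, of "r / 2"] r by (metis field_sum_of_halves half_gt_zero mult_2)
qed

definition truncate :: "nat \<Rightarrow> (nat ^ 'd \<Rightarrow> complex) \<Rightarrow> nat ^ 'd \<Rightarrow> complex" where
  "truncate n c \<alpha> = (if mi_length \<alpha> \<le> n then c \<alpha> else 0)"

lemma truncate_in_A_0: "truncate n c \<in> A_0"
  unfolding A_0_def truncate_def mem_Collect_eq
  by (rule finite_subset[OF _ finite_mi_length_le[of n]]) auto

text \<open>
  Beyond length \<open>n\<close> the weight with parameter \<open>2 * r\<close> gains a factor \<open>exp (- r * n\<^sup>a)\<close> over the one with
  parameter \<open>r\<close>; the second doubling passes from the sup norm to the \<open>\<ell>\<^sup>p\<close> norm.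
\<close>

lemma truncate_tendsto:
  assumes p: "p > 0" and s: "s > 0" and r: "r > 0" and c: "c \<in> seq_step p s r"
  shows "(\<lambda>n. seq_norm p s (4 * r) (\<lambda>\<alpha>. truncate n c \<alpha> - c \<alpha>)) \<longlonglongrightarrow> 0"
proof -
  define a where "a = 1 / (2 * s)"
  have a: "a > 0" using s by (simp add: a_def)
  obtain K where K: "K > 0"
    "\<And>(c :: nat ^ 'a \<Rightarrow> complex) M. (\<And>\<alpha>. norm (c \<alpha>) \<le> M * vartheta (2 * r) s \<alpha>) \<Longrightarrow>
      c \<in> seq_step p s (2 * (2 * r)) \<and> seq_norm p s (2 * (2 * r)) c \<le> K * M"
    using seq_step_sup_bound[OF p s, of "2 * r"] r by (metis mult_pos_pos zero_less_numeral)
  define N where "N = seq_norm p s r c"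
  have N: "N \<ge> 0" using seq_norm_nonneg[OF p c] by (simp add: N_def)
  have tail: "norm (truncate n c \<alpha> - c \<alpha>) \<le> (N * exp (- (r * real n powr a))) * vartheta (2 * r) s \<alpha>" for n \<alpha>
  proof (cases "mi_length \<alpha> \<le> n")
    case True
    then show ?thesis using N vartheta_pos[of "2 * r" s \<alpha>] by (simp add: truncate_def)
  next
    case False
    then have "r * real n powr a \<le> r * real (mi_length \<alpha>) powr a"
      using a r by (intro mult_left_mono powr_mono2) auto
    then have "vartheta r s \<alpha> \<le> exp (- (r * real n powr a)) * vartheta (2 * r) s \<alpha>"
      by (simp add: vartheta_def a_def exp_add[symmetric])
    then have "N * vartheta r s \<alpha> \<le> N * (exp (- (r * real n powr a)) * vartheta (2 * r) s \<alpha>)"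
      using N by (rule mult_left_mono)
    then show ?thesis
      using norm_le_seq_norm[OF p c, of \<alpha>] False by (simp add: truncate_def N_def mult.assoc)
  qed
  note bound = K(2)[OF tail]
  show ?thesis
  proof (rule tendsto_sandwich[OF always_eventually always_eventually tendsto_const])
    show "\<forall>n. 0 \<le> seq_norm p s (4 * r) (\<lambda>\<alpha>. truncate n c \<alpha> - c \<alpha>)"
      using seq_norm_nonneg[OF p] bound by fastforce
    show "\<forall>n. seq_norm p s (4 * r) (\<lambda>\<alpha>. truncate n c \<alpha> - c \<alpha>) \<le> K * (N * exp (- (r * real n powr a)))"
      using bound by simp
    show "(\<lambda>n. K * (N * exp (- (r * real n powr a)))) \<longlonglongrightarrow> 0" using a r by real_asymp
  qed
qed


section \<open>Weighted spaces of entire functions\<close>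

lemma omega2_pos: "omega2 r s z > 0"
  by (simp add: omega2_def)

lemma omega2_mono: "r \<le> r' \<Longrightarrow> omega2 r s z \<le> omega2 r' s z"
  by (simp add: omega2_def mult_right_mono)

abbreviation fun_step :: "real \<Rightarrow> real \<Rightarrow> (complex ^ 'd \<Rightarrow> complex) set" where
  "fun_step s r \<equiv> weighted_entire (omega2 r s)"

abbreviation fun_norm :: "real \<Rightarrow> real \<Rightarrow> (complex ^ 'd \<Rightarrow> complex) \<Rightarrow> real" where
  "fun_norm s r \<equiv> weighted_entire_norm (omega2 r s)"

lemma norm_le_fun_norm:
  assumes "F \<in> fun_step s r"
  shows "norm (F z) \<le> fun_norm s r F * omega2 r s z"
proof -
  have "norm (F z) / omega2 r s z \<le> fun_norm s r F"
    using assms unfolding weighted_entire_norm_def weighted_entire_def by (auto intro: cSUP_upper)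
  then show ?thesis using omega2_pos[of r s z] by (simp add: pos_divide_le_eq)
qed

lemma fun_stepI:
  assumes "F \<in> entire" "\<And>z. norm (F z) \<le> M * omega2 r s z"
  shows "F \<in> fun_step s r \<and> fun_norm s r F \<le> M"
proof -
  have "norm (F z) / omega2 r s z \<le> M" for z
    using assms(2)[of z] omega2_pos[of r s z] by (simp add: pos_divide_le_eq)
  then show ?thesis
    using assms(1) unfolding weighted_entire_norm_def weighted_entire_def
    by (auto intro!: cSUP_least bdd_aboveI[of _ M])
qed

lemma linear_scale_fun_step: "linear_scale (fun_step s :: real \<Rightarrow> (complex ^ 'd \<Rightarrow> complex) set)"
  unfolding linear_scale_def
proof (intro conjI allI impI ballI)
  show "(\<lambda>_. 0) \<in> fun_step s r" for r by (rule zero_in_weighted_entire)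
  fix r and F G :: "complex ^ 'd \<Rightarrow> complex" and a b
  assume F: "F \<in> fun_step s r" and G: "G \<in> fun_step s r"
  have "norm (a * F z + b * G z) \<le> (norm a * fun_norm s r F + norm b * fun_norm s r G) * omega2 r s z" for z
  proof -
    have "norm (a * F z + b * G z) \<le> norm a * norm (F z) + norm b * norm (G z)"
      using norm_triangle_ineq[of "a * F z" "b * G z"] by (simp add: norm_mult)
    also have "\<dots> \<le> norm a * (fun_norm s r F * omega2 r s z) + norm b * (fun_norm s r G * omega2 r s z)"
      by (intro add_mono mult_left_mono norm_le_fun_norm F G) auto
    finally show ?thesis by (simp add: algebra_simps)
  qed
  moreover have "(\<lambda>z. a * F z + b * G z) \<in> entire"
    using F G by (intro entire_linear_combination) (simp_all add: weighted_entire_def)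
  ultimately show "(\<lambda>z. a * F z + b * G z) \<in> fun_step s r" using fun_stepI by blast
next
  fix r r' :: real assume "r \<le> r'"
  show "fun_step s r \<subseteq> (fun_step s r' :: (complex ^ 'd \<Rightarrow> complex) set)"
  proof
    fix F :: "complex ^ 'd \<Rightarrow> complex" assume F: "F \<in> fun_step s r"
    have N: "fun_norm s r F \<ge> 0"
      using order_trans[OF norm_ge_zero norm_le_fun_norm[OF F, of 0]] omega2_pos[of r s "0 :: complex ^ 'd"]
      by (simp add: zero_le_mult_iff)
    have "norm (F z) \<le> fun_norm s r F * omega2 r' s z" for z
      using norm_le_fun_norm[OF F, of z] mult_left_mono[OF omega2_mono[OF \<open>r \<le> r'\<close>] N] order_trans by blast
    moreover have "F \<in> entire" using F by (simp add: weighted_entire_def)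
    ultimately show "F \<in> fun_step s r'" using fun_stepI by blast
  qed
qed

lemma fun_step_evaluation_bound: "\<exists>C>0. \<forall>F\<in>fun_step s r. norm (F z) \<le> C * fun_norm s r F"
  using omega2_pos[of r s z] norm_le_fun_norm[where r = r and s = s and z = z]
  by (intro exI[of _ "omega2 r s z"]) (auto simp: mult.commute)


section \<open>The two bounded maps\<close>

lemma everywhere_summable_linear_combination:
  assumes "everywhere_summable c" "everywhere_summable d"
  shows "everywhere_summable (\<lambda>\<alpha>. a * c \<alpha> + b * d \<alpha>)"
  unfolding everywhere_summable_def
proof
  fix z
  have "(\<lambda>\<alpha>. norm a * norm (c \<alpha> * e_basis \<alpha> z) + norm b * norm (d \<alpha> * e_basis \<alpha> z)) summable_on UNIV"
    using assms by (intro summable_on_add summable_on_cmult_right) (simp_all add: everywhere_summable_def)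
  then show "(\<lambda>\<alpha>. norm ((a * c \<alpha> + b * d \<alpha>) * e_basis \<alpha> z)) summable_on UNIV"
  proof (rule summable_on_comparison_test)
    show "norm ((a * c \<alpha> + b * d \<alpha>) * e_basis \<alpha> z) \<le>
        norm a * norm (c \<alpha> * e_basis \<alpha> z) + norm b * norm (d \<alpha> * e_basis \<alpha> z)" for \<alpha>
      using norm_triangle_ineq[of "a * c \<alpha> * e_basis \<alpha> z" "b * d \<alpha> * e_basis \<alpha> z"]
      by (simp add: norm_mult distrib_right mult.assoc)
  qed simp
qed

lemma basis_series_linear:
  assumes "everywhere_summable c" "everywhere_summable d"
  shows "basis_series (\<lambda>\<alpha>. a * c \<alpha> + b * d \<alpha>) UNIV
    = (\<lambda>z. a * basis_series c UNIV z + b * basis_series d UNIV z)"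
proof
  fix z
  have "((\<lambda>\<alpha>. a * (c \<alpha> * e_basis \<alpha> z) + b * (d \<alpha> * e_basis \<alpha> z)) has_sum
      a * basis_series c UNIV z + b * basis_series d UNIV z) UNIV"
    by (intro has_sum_add has_sum_cmult_right basis_series_has_sum assms)
  then show "basis_series (\<lambda>\<alpha>. a * c \<alpha> + b * d \<alpha>) UNIV z
      = a * basis_series c UNIV z + b * basis_series d UNIV z"
    unfolding basis_series_def[of "\<lambda>\<alpha>. a * c \<alpha> + b * d \<alpha>"]
    by (intro infsumI) (simp add: distrib_right mult.assoc)
qed

lemma everywhere_summable_taylor_map:
  assumes "F \<in> entire"
  shows "everywhere_summable (taylor_map F)"
  using has_sum_imp_summable[OF taylor_map_has_sum[OF assms]]
  by (simp add: everywhere_summable_def summable_on_iff_abs_summable_on_complex)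

text \<open>
  Linearity is inherited from the inverse map.
\<close>

lemma taylor_map_linear:
  assumes F: "F \<in> entire" and G: "G \<in> entire"
  shows "taylor_map (\<lambda>z. a * F z + b * G z) = (\<lambda>\<alpha>. a * taylor_map F \<alpha> + b * taylor_map G \<alpha>)"
proof -
  have "(\<lambda>z. a * F z + b * G z) = basis_series (\<lambda>\<alpha>. a * taylor_map F \<alpha> + b * taylor_map G \<alpha>) UNIV"
    using basis_series_linear[OF everywhere_summable_taylor_map[OF F] everywhere_summable_taylor_map[OF G]]
    by (simp add: basis_series_taylor_map F G)
  then show ?thesis
    using taylor_map_basis_series[OF everywhere_summable_linear_combination[OF
        everywhere_summable_taylor_map[OF F] everywhere_summable_taylor_map[OF G]]] by simp
qed

lemma basis_series_bound:
  fixes s r :: real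
  assumes p: "p > 0" and s: "s \<ge> 1 / 2" and r: "r > 0"
  obtains C where "C > 0" "\<And>(c :: nat ^ 'd \<Rightarrow> complex) \<rho>. c \<in> seq_step p s r \<Longrightarrow> growth_shift r \<le> \<rho> \<Longrightarrow>
    everywhere_summable c \<and> basis_series c UNIV \<in> fun_step s \<rho> \<and>
    fun_norm s \<rho> (basis_series c UNIV) \<le> C * seq_norm p s r c"
proof -
  obtain C where C: "C > 0" "\<And>A (z :: complex ^ 'd). finite A \<Longrightarrow>
      (\<Sum>\<alpha>\<in>A. vartheta r s \<alpha> * norm (e_basis \<alpha> z)) \<le> C * omega2 (growth_shift r) s z"
    using sum_vartheta_e_basis_le[OF s r] by metis
  show ?thesis
  proof (rule that[OF C(1)])
    fix c :: "nat ^ 'd \<Rightarrow> complex" and \<rho> assume c: "c \<in> seq_step p s r" and \<rho>: "growth_shift r \<le> \<rho>"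
    define N where "N = seq_norm p s r c"
    have N: "N \<ge> 0" using seq_norm_nonneg[OF p c] by (simp add: N_def)
    have fin: "(\<Sum>\<alpha>\<in>A. norm (c \<alpha> * e_basis \<alpha> z)) \<le> C * N * omega2 \<rho> s z" if "finite A" for A z
    proof -
      have "(\<Sum>\<alpha>\<in>A. norm (c \<alpha> * e_basis \<alpha> z)) \<le> (\<Sum>\<alpha>\<in>A. N * (vartheta r s \<alpha> * norm (e_basis \<alpha> z)))"
        using norm_le_seq_norm[OF p c]
        by (intro sum_mono) (simp add: norm_mult N_def mult.assoc[symmetric] mult_right_mono)
      also have "\<dots> = N * (\<Sum>\<alpha>\<in>A. vartheta r s \<alpha> * norm (e_basis \<alpha> z))"
        by (simp add: sum_distrib_left)
      also have "\<dots> \<le> N * (C * omega2 \<rho> s z)"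
        using C omega2_mono[OF \<rho>, of s z]
        by (intro mult_left_mono N order_trans[OF C(2)[OF that]]) auto
      finally show ?thesis by (simp add: mult_ac)
    qed
    have abs: "(\<lambda>\<alpha>. norm (c \<alpha> * e_basis \<alpha> z)) summable_on UNIV" for z
      using fin by (intro nonneg_bdd_above_summable_on bdd_aboveI[of _ "C * N * omega2 \<rho> s z"]) auto
    then have ev: "everywhere_summable c" by (simp add: everywhere_summable_def)
    have "norm (basis_series c UNIV z) \<le> C * N * omega2 \<rho> s z" for z
    proof -
      have "norm (basis_series c UNIV z) \<le> (\<Sum>\<^sub>\<infinity>\<alpha>. norm (c \<alpha> * e_basis \<alpha> z))"
        unfolding basis_series_def by (rule norm_infsum_bound[OF abs])
      also have "\<dots> \<le> C * N * omega2 \<rho> s z" by (rule infsum_le_finite_sums[OF abs fin])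
      finally show ?thesis .
    qed
    from fun_stepI[OF entire_basis_series[OF ev] this] ev
    show "everywhere_summable c \<and> basis_series c UNIV \<in> fun_step s \<rho> \<and>
        fun_norm s \<rho> (basis_series c UNIV) \<le> C * seq_norm p s r c" by (simp add: N_def)
  qed
qed

lemma taylor_map_seq_bound:
  fixes s r :: real
  assumes p: "p > 0" and s: "s > 0" and r: "r > 0"
  obtains C where "C > 0" "\<And>F :: complex ^ 'd \<Rightarrow> complex. F \<in> fun_step s r \<Longrightarrow>
    taylor_map F \<in> seq_step p s (4 * r) \<and> seq_norm p s (4 * r) (taylor_map F) \<le> C * fun_norm s r F"
proof -
  obtain C where C: "C > 0" "\<And>F N (\<alpha> :: nat ^ 'd). F \<in> entire \<Longrightarrow> (\<And>z. norm (F z) \<le> N * omega2 r s z) \<Longrightarrow>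
      norm (taylor_map F \<alpha>) \<le> C * N * vartheta (2 * r) s \<alpha>"
    using taylor_map_vartheta_bound[OF s r] by metis
  obtain K where K: "K > 0"
    "\<And>(c :: nat ^ 'd \<Rightarrow> complex) M. (\<And>\<alpha>. norm (c \<alpha>) \<le> M * vartheta (2 * r) s \<alpha>) \<Longrightarrow>
      c \<in> seq_step p s (2 * (2 * r)) \<and> seq_norm p s (2 * (2 * r)) c \<le> K * M"
    using seq_step_sup_bound[OF p s, of "2 * r"] r by (metis mult_pos_pos zero_less_numeral)
  show ?thesis
  proof (rule that[of "K * C"])
    show "K * C > 0" using K C by simp
    fix F :: "complex ^ 'd \<Rightarrow> complex" assume F: "F \<in> fun_step s r"
    then have "F \<in> entire" by (simp add: weighted_entire_def)
    from K(2)[OF C(2)[OF this norm_le_fun_norm[OF F]]]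
    show "taylor_map F \<in> seq_step p s (4 * r) \<and> seq_norm p s (4 * r) (taylor_map F) \<le> K * C * fun_norm s r F"
      by (simp add: mult.assoc)
  qed
qed

lemma growth_shift_le:
  assumes "\<rho> > 0"
  obtains r where "r > 0" "growth_shift r \<le> \<rho>"
proof -
  define r where "r = min 1 (\<rho> / (2 * (1 + exp 4)))"
  have pos: "(0 :: real) < 2 * (1 + exp 4)" by (simp add: add_pos_pos)
  have r: "r > 0" "r \<le> 1" "r \<le> \<rho> / (2 * (1 + exp 4))"
    using assms pos by (auto simp: r_def)
  have "growth_shift r \<le> 2 * r * (1 + exp 4)"
    unfolding growth_shift_def using r by (intro mult_left_mono) auto
  also have "\<dots> \<le> \<rho>" using r(3) pos by (simp add: pos_le_divide_eq mult_ac)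
  finally show ?thesis using that r(1) by blast
qed

lemma growth_shift_pos: "r > 0 \<Longrightarrow> growth_shift r > 0"
  by (simp add: growth_shift_def add_pos_pos)

lemma basis_series_eq_P_map:
  assumes "c \<in> A_0"
  shows "basis_series c UNIV = P_map c"
proof
  fix z
  have "basis_series c UNIV z = (\<Sum>\<^sub>\<infinity>\<alpha>\<in>{\<alpha>. c \<alpha> \<noteq> 0}. c \<alpha> * e_basis \<alpha> z)"
    unfolding basis_series_def by (rule infsum_cong_neutral) auto
  then show "basis_series c UNIV z = P_map c z"
    using assms by (simp add: P_map_def A_0_def)
qed


section \<open>Homeomorphic extension\<close>

theorem theorem5p4:
  fixes s :: real and p :: ennreal
  assumes "s \<ge> 1 / 2" and "p > 0"
  shows "extends_uniquely_to_homeomorphism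
           (P_map :: (nat ^ 'd \<Rightarrow> complex) \<Rightarrow> complex ^ 'd \<Rightarrow> complex) A_0
           (A_s_dual p s) (entire_every (\<lambda>r. omega2 r s))
       \<and> (s \<noteq> 1 / 2 \<longrightarrow> extends_uniquely_to_homeomorphism
           (P_map :: (nat ^ 'd \<Rightarrow> complex) \<Rightarrow> complex ^ 'd \<Rightarrow> complex) A_0
           (A_0s_dual p s) (entire_some (\<lambda>r. omega2 r s)))"
proof -
  note p = \<open>p > 0\<close>
  have s: "s > 0" using assms(1) by linarith
  let ?P = "\<lambda>c :: nat ^ 'd \<Rightarrow> complex. basis_series c UNIV"
  let ?X = "seq_step p s :: real \<Rightarrow> (nat ^ 'd \<Rightarrow> complex) set" and ?Y = "fun_step s :: real \<Rightarrow> (complex ^ 'd \<Rightarrow> complex) set"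
  have X: "linear_scale ?X" by (rule linear_scale_seq_step[OF p])
  have Y: "linear_scale ?Y" by (rule linear_scale_fun_step)
  have ev: "everywhere_summable c" if "c \<in> (\<Union>r\<in>{0<..}. ?X r)" for c
    using that basis_series_bound[OF p assms(1)] by (metis UN_E greaterThan_iff order_refl)
  have ent: "F \<in> entire" if "F \<in> (\<Union>r\<in>{0<..}. ?Y r)" for F
    using that by (auto simp: weighted_entire_def)
  have P_lin: "complex_linear_on (\<Union>r\<in>{0<..}. ?X r) ?P"
    unfolding complex_linear_on_def by (intro ballI allI basis_series_linear ev)
  have T_lin: "complex_linear_on (\<Union>r\<in>{0<..}. ?Y r) taylor_map"
    unfolding complex_linear_on_def by (intro ballI allI taylor_map_linear ent)
  have sub: "(\<Inter>r\<in>{0<..}. S r) \<subseteq> (\<Union>r\<in>{0<..}. S r)" for S :: "real \<Rightarrow> 'z set"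
    using zero_less_one[where 'a = real] by blast
  show ?thesis
  proof (intro conjI impI)
    show "extends_uniquely_to_homeomorphism (P_map :: (nat ^ 'd \<Rightarrow> complex) \<Rightarrow> _) A_0
        (A_s_dual p s) (entire_every (\<lambda>r. omega2 r s))"
    proof (rule extends_uniquely_to_homeomorphismI[where g = ?P])
      show "A_0 \<subseteq> topspace (A_s_dual p s :: (nat ^ 'd \<Rightarrow> complex) topology)"
        using A_0_subset_seq_step[OF p s] by (auto simp: topspace_A_s_dual)
      show "topspace (A_s_dual p s) \<subseteq> (A_s_dual p s :: (nat ^ 'd \<Rightarrow> complex) topology) closure_of A_0"
      proof
        fix c :: "nat ^ 'd \<Rightarrow> complex" assume "c \<in> topspace (A_s_dual p s)"
        then have c: "c \<in> (\<Inter>r\<in>{0<..}. ?X r)" by (simp add: topspace_A_s_dual)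
        show "c \<in> A_s_dual p s closure_of A_0"
          unfolding A_s_dual_def
        proof (rule closure_of_projective_limit[OF c, of "\<lambda>n. truncate n c"])
          show "truncate n c \<in> A_0" for n by (rule truncate_in_A_0)
          show "truncate n c \<in> (\<Inter>r\<in>{0<..}. ?X r)" for n
            using A_0_subset_seq_step[OF p s truncate_in_A_0] by auto
          show "(\<lambda>n. seq_norm p s r (\<lambda>i. truncate n c i - c i)) \<longlonglongrightarrow> 0" if "r > 0" for r
            using truncate_tendsto[OF p s, of "r / 4" c] c that by simp
        qed
      qed
      show "?P c = P_map c" if "c \<in> A_0" for c by (rule basis_series_eq_P_map[OF that])
      show "continuous_map (entire_every (\<lambda>r. omega2 r s)) euclidean (\<lambda>F :: complex ^ 'd \<Rightarrow> complex. F z)" for z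
        unfolding entire_every_def
        by (rule continuous_map_evaluation_projective[OF Y fun_step_evaluation_bound])
      have "continuous_map (A_s_dual p s) (entire_every (\<lambda>r. omega2 r s)) ?P"
        unfolding A_s_dual_def entire_every_def
      proof (rule continuous_map_projective_limit[OF X P_lin])
        fix \<rho> :: real assume "\<rho> > 0"
        then obtain r where r: "r > 0" "growth_shift r \<le> \<rho>" by (rule growth_shift_le)
        show "\<exists>r'>0. \<exists>C>0. \<forall>c\<in>?X r'. ?P c \<in> ?Y \<rho> \<and> fun_norm s \<rho> (?P c) \<le> C * seq_norm p s r' c"
          using basis_series_bound[OF p assms(1) r(1)] r by metis
      qed
      moreover have "continuous_map (entire_every (\<lambda>r. omega2 r s)) (A_s_dual p s)
          (taylor_map :: (complex ^ 'd \<Rightarrow> complex) \<Rightarrow> _)"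
        unfolding A_s_dual_def entire_every_def
      proof (rule continuous_map_projective_limit[OF Y T_lin])
        fix r :: real assume "r > 0"
        then have r: "r / 4 > 0" "4 * (r / 4) = r" by auto
        show "\<exists>r'>0. \<exists>C>0. \<forall>F\<in>?Y r'. taylor_map F \<in> ?X r \<and> seq_norm p s r (taylor_map F) \<le> C * fun_norm s r' F"
          using taylor_map_seq_bound[OF p s r(1)] r by metis
      qed
      moreover have "taylor_map (?P c) = c" if "c \<in> topspace (A_s_dual p s)" for c
        using subsetD[OF sub[of ?X]] that by (intro taylor_map_basis_series ev) (simp add: topspace_A_s_dual)
      moreover have "?P (taylor_map F) = F" if "F \<in> topspace (entire_every (\<lambda>r. omega2 r s))" for F
        using that by (intro basis_series_taylor_map) (simp add: topspace_entire_every omega2_pos)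
      ultimately have "homeomorphic_maps (A_s_dual p s) (entire_every (\<lambda>r. omega2 r s)) ?P taylor_map"
        unfolding homeomorphic_maps_def by blast
      then show "homeomorphic_map (A_s_dual p s) (entire_every (\<lambda>r. omega2 r s)) ?P"
        by (rule homeomorphic_maps_imp_map)
    qed
  next
    show "extends_uniquely_to_homeomorphism (P_map :: (nat ^ 'd \<Rightarrow> complex) \<Rightarrow> _) A_0
        (A_0s_dual p s) (entire_some (\<lambda>r. omega2 r s))"
    proof (rule extends_uniquely_to_homeomorphismI[where g = ?P])
      show "A_0 \<subseteq> topspace (A_0s_dual p s :: (nat ^ 'd \<Rightarrow> complex) topology)"
        using A_0_subset_seq_step[OF p s _ zero_less_one] by (auto simp: topspace_A_0s_dual intro!: bexI[of _ 1])
      show "topspace (A_0s_dual p s) \<subseteq> (A_0s_dual p s :: (nat ^ 'd \<Rightarrow> complex) topology) closure_of A_0"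
      proof
        fix c :: "nat ^ 'd \<Rightarrow> complex" assume "c \<in> topspace (A_0s_dual p s)"
        then obtain r where r: "r > 0" "c \<in> ?X r" by (auto simp: topspace_A_0s_dual)
        show "c \<in> A_0s_dual p s closure_of A_0"
          unfolding A_0s_dual_def
        proof (rule closure_of_inductive_limit[OF X, of "4 * r" c "\<lambda>n. truncate n c"])
          show "4 * r > 0" using r by simp
          show "c \<in> ?X (4 * r)" using linear_scaleD(3)[OF X r(1), of "4 * r"] r by auto
          show "truncate n c \<in> A_0" for n by (rule truncate_in_A_0)
          show "truncate n c \<in> ?X (4 * r)" for n
            by (rule A_0_subset_seq_step[OF p s truncate_in_A_0]) (use r in simp)
          show "(\<lambda>n. seq_norm p s (4 * r) (\<lambda>i. truncate n c i - c i)) \<longlonglongrightarrow> 0"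
            by (rule truncate_tendsto[OF p s r])
        qed
      qed
      show "?P c = P_map c" if "c \<in> A_0" for c by (rule basis_series_eq_P_map[OF that])
      show "continuous_map (entire_some (\<lambda>r. omega2 r s)) euclidean (\<lambda>F :: complex ^ 'd \<Rightarrow> complex. F z)" for z
        unfolding entire_some_def
        by (rule continuous_map_evaluation_inductive[OF Y fun_step_evaluation_bound])
      have "continuous_map (A_0s_dual p s) (entire_some (\<lambda>r. omega2 r s)) ?P"
        unfolding A_0s_dual_def entire_some_def
      proof (rule continuous_map_inductive_limit[OF X Y P_lin])
        fix r :: real assume r: "r > 0"
        show "\<exists>r'>0. \<exists>C>0. \<forall>c\<in>?X r. ?P c \<in> ?Y r' \<and> fun_norm s r' (?P c) \<le> C * seq_norm p s r c"
          using basis_series_bound[OF p assms(1) r] growth_shift_pos[OF r] by (metis order_refl)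
      qed
      moreover have "continuous_map (entire_some (\<lambda>r. omega2 r s)) (A_0s_dual p s)
          (taylor_map :: (complex ^ 'd \<Rightarrow> complex) \<Rightarrow> _)"
        unfolding A_0s_dual_def entire_some_def
      proof (rule continuous_map_inductive_limit[OF Y X T_lin])
        fix r :: real assume r: "r > 0"
        then have "4 * r > 0" by simp
        then show "\<exists>r'>0. \<exists>C>0. \<forall>F\<in>?Y r. taylor_map F \<in> ?X r' \<and> seq_norm p s r' (taylor_map F) \<le> C * fun_norm s r F"
          using taylor_map_seq_bound[OF p s r] by metis
      qed
      moreover have "taylor_map (?P c) = c" if "c \<in> topspace (A_0s_dual p s)" for c
        using that ev by (intro taylor_map_basis_series) (auto simp: topspace_A_0s_dual)
      moreover have "?P (taylor_map F) = F" if "F \<in> topspace (entire_some (\<lambda>r. omega2 r s))" for F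
        using that by (intro basis_series_taylor_map) (simp add: topspace_entire_some omega2_pos)
      ultimately have "homeomorphic_maps (A_0s_dual p s) (entire_some (\<lambda>r. omega2 r s)) ?P taylor_map"
        unfolding homeomorphic_maps_def by blast
      then show "homeomorphic_map (A_0s_dual p s) (entire_some (\<lambda>r. omega2 r s)) ?P"
        by (rule homeomorphic_maps_imp_map)
    qed
  qed
qed

end
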